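(* Let $\{\Phi_n\}_n$ be a sequence of functions in $\mathcal{G}_\infty$ converging uniformly on compact subsets of $\mathbb{C}_+$ to a function $\Phi$. Then $\Phi_n\to\Phi$ uniformly on $\mathbb{C}_\varepsilon$ for every $\varepsilon>0$, and either (1) $\Phi\in\mathcal{G}_\infty$, or (2) there is $t\in\mathbb{R}$ such that $\Phi(s)=it$ for all $s\in\mathbb{C}_+$. In other words, the union of $\mathcal{G}_\infty$ and the set of constant functions with value in $i\mathbb{R}$ is closed for the topology of uniform convergence on compact subsets of $\mathbb{C}_+$. Moreover, in case (1), $c_{\Phi_n}=c_\Phi$ for $n$ large enough; in case (2), $c_{\Phi_n}=0$ for $n$ large enough.
   Context: $\mathbb{N}=\{1,2,\dots\}$. For $\theta\in\mathbb{R}$, $\mathbb{C}_\theta=\{s\in\mathbb{C}:\mathrm{Re}(s)>\theta\}$ and $\mathbb{C}_+=\mathbb{C}_0$. $\mathcal{D}$ is the set of Dirichlet series $\sum_{n\ge1}a_nn^{-s}$ that converge in some half-plane $\mathbb{C}_\theta$; an analytic function on $\mathbb{C}_+$ is said to be in $\mathcal{D}$ if it coincides with such a series on some half-plane. An analytic $\Phi:\mathbb{C}_+\to\mathbb{C}_+$ is in $\mathcal{G}_\infty$ if there are $c_\Phi\in\mathbb{N}\cup\{0\}$ and $\varphi\in\mathcal{D}$ with $\Phi(s)=c_\Phi s+\varphi(s)$; the integer $c_\Phi$ is called the characteristic of $\Phi$. *)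

theory Defs
  imports "HOL-Complex_Analysis.Complex_Analysis"
begin

definition half_plane :: "real \<Rightarrow> complex set" where
  "half_plane \<theta> = {s. Re s > \<theta>}"

text \<open>
  Functions on the right half-plane are represented by total functions whose values outside
  \<open>half_plane 0\<close> are irrelevant. Since \<open>\<theta>\<close> may always be increased, the values of \<open>f\<close> at points with
  nonpositive real part do not influence membership in \<open>dirichlet_class\<close>. Convergence of the series
  need not be absolute.
\<close>

definition dirichlet_class :: "(complex \<Rightarrow> complex) set" where
  "dirichlet_class = {f. f holomorphic_on half_plane 0 \<and>
     (\<exists>(a :: nat \<Rightarrow> complex) \<theta>. \<forall>s\<in>half_plane \<theta>.
        (\<lambda>n. a (Suc n) * of_nat (Suc n) powr (- s)) sums f s)}"

definition has_characteristic :: "(complex \<Rightarrow> complex) \<Rightarrow> nat \<Rightarrow> bool" where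
  "has_characteristic \<Phi> c \<longleftrightarrow>
     (\<exists>\<phi>\<in>dirichlet_class. \<forall>s\<in>half_plane 0. \<Phi> s = of_nat c * s + \<phi> s)"

definition G_infinity :: "(complex \<Rightarrow> complex) set" where
  "G_infinity = {\<Phi>. \<Phi> holomorphic_on half_plane 0 \<and> \<Phi> ` half_plane 0 \<subseteq> half_plane 0 \<and>
     (\<exists>c. has_characteristic \<Phi> c)}"

definition characteristic :: "(complex \<Rightarrow> complex) \<Rightarrow> nat" where
  "characteristic \<Phi> = (THE c. has_characteristic \<Phi> c)"

lemma dirichlet_class_bounded:
  assumes "f \<in> dirichlet_class"
  obtains B x0 where "\<And>x::real. x \<ge> x0 \<Longrightarrow> norm (f (of_real x)) \<le> B"
proof -
  obtain a :: "nat \<Rightarrow> complex" and \<theta> where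
    sums: "\<And>s. Re s > \<theta> \<Longrightarrow> (\<lambda>n. a (Suc n) * of_nat (Suc n) powr (- s)) sums f s"
    using assms by (auto simp: dirichlet_class_def half_plane_def)
  define y where "y = \<theta> + 1"
  have "summable (\<lambda>n. a (Suc n) * of_nat (Suc n) powr (- complex_of_real y))"
    using sums[of "of_real y"] by (auto simp: y_def sums_iff)
  then have "Bseq (\<lambda>n. a (Suc n) * of_nat (Suc n) powr (- complex_of_real y))"
    using summable_LIMSEQ_zero convergentI convergent_imp_Bseq by blast
  then obtain M where M: "\<And>n. norm (a (Suc n) * of_nat (Suc n) powr (- complex_of_real y)) \<le> M"
    by (auto simp: Bseq_def)
  have nrm: "norm (of_nat (Suc n) powr (- complex_of_real x)) = real (Suc n) powr (- x)" for n x
    using norm_powr_real_powr[of "of_nat (Suc n)" "- complex_of_real x"]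
    by (simp del: of_nat_Suc)
  have sumI: "summable (\<lambda>n. M * real (Suc n) powr (-2))"
  proof -
    have "summable (\<lambda>n. real n powr (-2))" by (simp add: summable_real_powr_iff)
    then have "summable (\<lambda>n. real (Suc n) powr (-2))" by (subst summable_Suc_iff)
    then show ?thesis by (rule summable_mult)
  qed
  show thesis
  proof (rule that[of "y + 2" "\<Sum>n. M * real (Suc n) powr (-2)"])
    fix x :: real assume x: "x \<ge> y + 2"
    have le: "norm (a (Suc n) * of_nat (Suc n) powr (- complex_of_real x))
                \<le> M * real (Suc n) powr (-2)" for n
    proof -
      have "real (Suc n) powr (- x) \<le> real (Suc n) powr (- y + -2)"
        using x by (intro powr_mono) auto
      also have "\<dots> = real (Suc n) powr (- y) * real (Suc n) powr (-2)"
        by (rule powr_add)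
      finally have "norm (a (Suc n)) * real (Suc n) powr (- x)
          \<le> (norm (a (Suc n)) * real (Suc n) powr (- y)) * real (Suc n) powr (-2)"
        by (metis mult.assoc mult_left_mono norm_ge_zero)
      also have "\<dots> \<le> M * real (Suc n) powr (-2)"
        using M[of n] by (intro mult_right_mono) (simp_all add: norm_mult nrm del: of_nat_Suc)
      finally show ?thesis by (simp add: norm_mult nrm del: of_nat_Suc)
    qed
    have "f (of_real x) = (\<Sum>n. a (Suc n) * of_nat (Suc n) powr (- complex_of_real x))"
      using sums[of "of_real x"] x by (simp add: y_def sums_iff)
    also have "norm \<dots> \<le> (\<Sum>n. M * real (Suc n) powr (-2))"
      by (rule norm_suminf_le[OF le sumI])
    finally show "norm (f (of_real x)) \<le> (\<Sum>n. M * real (Suc n) powr (-2))" .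
  qed
qed

lemma has_characteristic_unique:
  assumes "has_characteristic \<Phi> c" "has_characteristic \<Phi> d"
  shows "c = d"
proof (rule ccontr)
  assume "c \<noteq> d"
  obtain f where f: "f \<in> dirichlet_class" "\<And>s. Re s > 0 \<Longrightarrow> \<Phi> s = of_nat c * s + f s"
    using assms(1) unfolding has_characteristic_def half_plane_def by blast
  obtain g where g: "g \<in> dirichlet_class" "\<And>s. Re s > 0 \<Longrightarrow> \<Phi> s = of_nat d * s + g s"
    using assms(2) unfolding has_characteristic_def half_plane_def by blast
  obtain B x0 where B: "\<And>x::real. x \<ge> x0 \<Longrightarrow> norm (f (of_real x)) \<le> B"
    using dirichlet_class_bounded[OF f(1)] by blast
  obtain C x1 where C: "\<And>x::real. x \<ge> x1 \<Longrightarrow> norm (g (of_real x)) \<le> C"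
    using dirichlet_class_bounded[OF g(1)] by blast
  define x where "x = max (max x0 x1) (max 1 (B + C + 1))"
  have x: "x \<ge> x0" "x \<ge> x1" "x \<ge> 1" "x > B + C" by (auto simp: x_def)
  have "of_nat c * of_real x + f (of_real x) = of_nat d * of_real x + g (of_real x)"
    using f(2)[of "of_real x"] g(2)[of "of_real x"] x by simp
  then have eq: "of_real ((real c - real d) * x) = g (of_real x) - f (of_real x)"
    by (simp add: algebra_simps)
  have "\<bar>real c - real d\<bar> * x = norm (complex_of_real ((real c - real d) * x))"
    using x by (simp only: norm_of_real abs_mult)
  also have "\<dots> \<le> B + C"
    unfolding eq using norm_triangle_ineq4[of "g (of_real x)" "f (of_real x)"] B[OF x(1)] C[OF x(2)]
    by linarith
  finally have "\<bar>real c - real d\<bar> * x \<le> B + C" .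
  moreover have "1 * x \<le> \<bar>real c - real d\<bar> * x"
    using \<open>c \<noteq> d\<close> x by (intro mult_right_mono) auto
  ultimately show False using x by linarith
qed

lemma characteristic_eqI: "has_characteristic \<Phi> c \<Longrightarrow> characteristic \<Phi> = c"
  unfolding characteristic_def using has_characteristic_unique by blast

definition imaginary_constants :: "(complex \<Rightarrow> complex) set" where
  "imaginary_constants = {\<Phi>. \<exists>t::real. \<forall>s\<in>half_plane 0. \<Phi> s = \<i> * of_real t}"

text \<open>
  The topology of uniform convergence on compact subsets of \<open>S\<close>, on the space of all functions:
  the sets \<open>{g. \<forall>z\<in>K. dist (g z) (f z) < e}\<close> form a neighbourhood base at \<open>f\<close>. Functions that agree
  on \<open>S\<close> are topologically indistinguishable.
\<close>

definition compact_convergence_topology ::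
  "'a::topological_space set \<Rightarrow> ('a \<Rightarrow> 'b::metric_space) topology" where
  "compact_convergence_topology S = topology (\<lambda>U. \<forall>f\<in>U. \<exists>K e. compact K \<and> K \<subseteq> S \<and> e > 0 \<and>
     {g. \<forall>z\<in>K. dist (g z) (f z) < e} \<subseteq> U)"

lemma openin_compact_convergence_topology:
  fixes U :: "('a::topological_space \<Rightarrow> 'b::metric_space) set"
  shows "openin (compact_convergence_topology S) U \<longleftrightarrow>
     (\<forall>f\<in>U. \<exists>K e. compact K \<and> K \<subseteq> S \<and> e > 0 \<and> {g. \<forall>z\<in>K. dist (g z) (f z) < e} \<subseteq> U)"
proof -
  let ?P = "\<lambda>U :: ('a \<Rightarrow> 'b) set. \<forall>f\<in>U. \<exists>K e. compact K \<and> K \<subseteq> S \<and> e > 0 \<and> {g. \<forall>z\<in>K. dist (g z) (f z) < e} \<subseteq> U"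
  have "istopology ?P"
    unfolding istopology_def
  proof (intro conjI allI impI)
    fix U V assume U: "?P U" and V: "?P V"
    show "?P (U \<inter> V)"
    proof
      fix f assume f: "f \<in> U \<inter> V"
      obtain K e where K: "compact K" "K \<subseteq> S" "e > 0" "{g. \<forall>z\<in>K. dist (g z) (f z) < e} \<subseteq> U"
        using bspec[OF U, of f] f by auto
      obtain L d where L: "compact L" "L \<subseteq> S" "d > 0" "{g. \<forall>z\<in>L. dist (g z) (f z) < d} \<subseteq> V"
        using bspec[OF V, of f] f by auto
      have "{g. \<forall>z\<in>K \<union> L. dist (g z) (f z) < min e d} \<subseteq> U \<inter> V"
        using K(4) L(4) by auto
      moreover have "compact (K \<union> L)" "K \<union> L \<subseteq> S" "min e d > 0"
        using K L by auto
      ultimately show "\<exists>K e. compact K \<and> K \<subseteq> S \<and> e > 0 \<and>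
          {g. \<forall>z\<in>K. dist (g z) (f z) < e} \<subseteq> U \<inter> V"
        by (intro exI[of _ "K \<union> L"] exI[of _ "min e d"] conjI)
    qed
  next
    fix \<K> assume *: "\<forall>U\<in>\<K>. ?P U"
    show "?P (\<Union>\<K>)"
    proof
      fix f assume "f \<in> \<Union>\<K>"
      then obtain U where U: "U \<in> \<K>" "f \<in> U" by blast
      obtain K e where K: "compact K" "K \<subseteq> S" "e > 0" "{g. \<forall>z\<in>K. dist (g z) (f z) < e} \<subseteq> U"
        using bspec[OF bspec[OF * U(1)] U(2)] by auto
      have "{g. \<forall>z\<in>K. dist (g z) (f z) < e} \<subseteq> \<Union>\<K>"
        using K(4) U(1) by auto
      with K show "\<exists>K e. compact K \<and> K \<subseteq> S \<and> e > 0 \<and>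
          {g. \<forall>z\<in>K. dist (g z) (f z) < e} \<subseteq> \<Union>\<K>"
        by (intro exI[of _ K] exI[of _ e] conjI)
    qed
  qed
  then show ?thesis
    by (simp add: compact_convergence_topology_def topology_inverse')
qed

lemma topspace_compact_convergence_topology [simp]:
  "topspace (compact_convergence_topology S) = UNIV"
proof -
  have "openin (compact_convergence_topology S) UNIV"
    unfolding openin_compact_convergence_topology
    by (intro ballI exI[of _ "{}"] exI[of _ 1]) auto
  then show ?thesis using openin_subset by blast
qed

end

theory Submission
  imports Defs "HOL-Real_Asymp.Real_Asymp"
begin

text \<open>
  Write \<open>F n s = c n * s + \<phi> n s\<close>. By the Phragmen-Lindelof principle for \<open>exp (- \<phi> n)\<close>, the Dirichlet series
  \<open>\<phi> n\<close> has nonnegative real part. For such a series \<open>\<Sum>k. a k * k powr (- s)\<close>, averaging vertical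
  translates against nonnegative weights gives \<open>norm (a k) \<le> 2 * Re (a 1)\<close> for \<open>k \<ge> 2\<close>, whence the series
  converges absolutely for \<open>Re s > 1\<close> and is controlled on \<open>Re s \<ge> 4\<close> by its value at \<open>4\<close>, and by the
  Schwarz lemma on every \<open>Re s \<ge> \<epsilon>\<close>. Along the sequence these bounds are uniform in \<open>n\<close>. Hence
  \<open>F n x / x\<close> determines \<open>c n\<close> for large \<open>x\<close>, so \<open>c n\<close> is eventually constant. The coefficients
  converge by recursion on the index, hence the series converge uniformly far to the right, and the three lines theorem
  extends this to every \<open>Re s > \<epsilon>\<close>.
\<close>

section \<open>The three lines theorem\<close>

lemma mem_half_plane [simp]: "s \<in> half_plane a \<longleftrightarrow> Re s > a"
  by (simp add: half_plane_def)

lemma open_half_plane: "open (half_plane a)"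
  unfolding half_plane_def by (rule open_halfspace_Re_gt)

lemma convex_half_plane: "convex (half_plane a)"
  unfolding half_plane_def by (rule convex_halfspace_Re_gt)

text \<open>The factor \<open>exp (\<eta> * z ^ 2)\<close> decays as \<open>Im z\<close> grows, so
  the maximum modulus principle applies on a tall rectangle; letting \<open>\<eta>\<close> tend to 0
  then removes the factor.\<close>

lemma strip_maximum_modulus:
  assumes hol: "f holomorphic_on half_plane 0" and a: "0 < a" and C: "0 < C"
    and bdd: "\<And>s. a \<le> Re s \<Longrightarrow> Re s \<le> b \<Longrightarrow> norm (f s) \<le> M"
    and bda: "\<And>s. Re s = a \<Longrightarrow> norm (f s) \<le> C"
    and bdb: "\<And>s. Re s = b \<Longrightarrow> norm (f s) \<le> C"
    and s: "a \<le> Re s" "Re s \<le> b"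
  shows "norm (f s) \<le> C"
proof -
  have *: "norm (f s) \<le> C * exp (\<eta> * (b\<^sup>2 - (Re s)\<^sup>2 + (Im s)\<^sup>2))" if \<eta>: "\<eta> > 0" for \<eta>
  proof -
    define h where "h = (\<lambda>z. f z * exp (of_real \<eta> * z\<^sup>2))"
    have norm_h: "norm (h z) = norm (f z) * exp (\<eta> * ((Re z)\<^sup>2 - (Im z)\<^sup>2))" for z
      by (simp add: h_def norm_mult Re_power2)
    have hol_h: "h holomorphic_on half_plane 0"
      unfolding h_def by (intro holomorphic_intros hol)
    \<comment> \<open>The height \<open>T\<close> is chosen so that the Gaussian decay brings the
      crude bound \<open>M\<close> below \<open>C\<close> on the horizontal sides.\<close>
    have "((\<lambda>T. M * exp (- \<eta> * T\<^sup>2)) \<longlongrightarrow> 0) at_top"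
      using \<eta> by real_asymp
    then have "eventually (\<lambda>T. M * exp (- \<eta> * T\<^sup>2) < C) at_top"
      using C by (rule order_tendstoD)
    then have "eventually (\<lambda>T. M * exp (- \<eta> * T\<^sup>2) < C \<and> T \<ge> \<bar>Im s\<bar>) at_top"
      by (intro eventually_conj eventually_ge_at_top)
    then obtain T where T: "M * exp (- \<eta> * T\<^sup>2) < C" "T \<ge> \<bar>Im s\<bar>"
      by (metis (mono_tags, lifting) eventually_happens trivial_limit_at_top_linorder)
    let ?R = "cbox (Complex a (-T)) (Complex b T)"
    have sub: "?R \<subseteq> half_plane 0"
      using a by (auto simp: in_cbox_complex_iff)
    have "norm (h s) \<le> C * exp (\<eta> * b\<^sup>2)"
    proof (rule maximum_modulus_frontier[of h ?R])
      show "h holomorphic_on interior ?R"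
        using hol_h sub interior_subset by (metis holomorphic_on_subset)
      show "continuous_on (closure ?R) h"
        using hol_h sub by (simp add: holomorphic_on_imp_continuous_on holomorphic_on_subset)
      show "s \<in> ?R" using s T by (auto simp: in_cbox_complex_iff)
      fix z assume "z \<in> frontier ?R"
      then have z: "z \<in> ?R" "z \<notin> box (Complex a (-T)) (Complex b T)"
        by (auto simp: frontier_cbox)
      have le: "(Re z)\<^sup>2 \<le> b\<^sup>2"
        using z(1) a by (intro power_mono) (auto simp: in_cbox_complex_iff)
      consider "Re z = a \<or> Re z = b" | "\<bar>Im z\<bar> = T"
        using z by (force simp: in_cbox_complex_iff in_box_complex_iff)
      then show "norm (h z) \<le> C * exp (\<eta> * b\<^sup>2)"
      proof cases
        case 1
        then have "norm (f z) \<le> C" using bda bdb by blast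
        moreover have "exp (\<eta> * ((Re z)\<^sup>2 - (Im z)\<^sup>2)) \<le> exp (\<eta> * b\<^sup>2)"
          using le \<eta> by (smt (verit) exp_le_cancel_iff mult_le_cancel_left_pos zero_le_power2)
        ultimately show ?thesis unfolding norm_h using C by (intro mult_mono) auto
      next
        case 2
        then have T2: "(Im z)\<^sup>2 = T\<^sup>2" by (metis power2_abs)
        have "norm (f z) \<le> M" using z(1) bdd by (auto simp: in_cbox_complex_iff)
        then have "norm (h z) \<le> M * exp (\<eta> * ((Re z)\<^sup>2 - (Im z)\<^sup>2))"
          unfolding norm_h by (intro mult_right_mono) auto
        also have "\<dots> = (M * exp (- \<eta> * T\<^sup>2)) * exp (\<eta> * (Re z)\<^sup>2)"
          by (simp add: T2 algebra_simps flip: exp_add)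
        also have "\<dots> \<le> C * exp (\<eta> * b\<^sup>2)"
          using T(1) C le \<eta> by (intro mult_mono) auto
        finally show ?thesis .
      qed
    qed auto
    then have "norm (f s) \<le> C * exp (\<eta> * b\<^sup>2) / exp (\<eta> * ((Re s)\<^sup>2 - (Im s)\<^sup>2))"
      by (simp add: norm_h field_simps)
    also have "\<dots> = C * exp (\<eta> * (b\<^sup>2 - (Re s)\<^sup>2 + (Im s)\<^sup>2))"
      by (simp add: right_diff_distrib distrib_left exp_diff exp_add)
    finally show ?thesis .
  qed
  have "((\<lambda>\<eta>. C * exp (\<eta> * (b\<^sup>2 - (Re s)\<^sup>2 + (Im s)\<^sup>2))) \<longlongrightarrow>
      C * exp (0 * (b\<^sup>2 - (Re s)\<^sup>2 + (Im s)\<^sup>2))) (at_right 0)"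
    by (intro tendsto_intros)
  then show ?thesis
    using * by (intro tendsto_lowerbound[where F = "at_right (0::real)"])
      (auto simp: eventually_at_right_less intro!: eventually_at_rightI[of 0 1])
qed

text \<open>The exponent \<open>\<kappa>\<close> makes
  \<open>exp (\<kappa> * (b - a)) = A / B\<close>, so multiplying by
  \<open>exp (\<kappa> * (z - a))\<close> equalises the bounds on the two lines to \<open>A\<close>
  and the maximum principle for the strip applies.\<close>

lemma hadamard_three_lines:
  assumes hol: "f holomorphic_on half_plane 0" and ab: "0 < a" "a < b" and AB: "0 < A" "0 < B"
    and bdd: "\<And>s. a \<le> Re s \<Longrightarrow> Re s \<le> b \<Longrightarrow> norm (f s) \<le> M"
    and bda: "\<And>s. Re s = a \<Longrightarrow> norm (f s) \<le> A"
    and bdb: "\<And>s. Re s = b \<Longrightarrow> norm (f s) \<le> B"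
    and s: "a \<le> Re s" "Re s \<le> b"
  shows "norm (f s) \<le> A * (B / A) powr ((Re s - a) / (b - a))"
proof -
  define \<kappa> where "\<kappa> = ln (A / B) / (b - a)"
  define g where "g = (\<lambda>z. f z * exp (of_real \<kappa> * (z - of_real a)))"
  have norm_g: "norm (g z) = norm (f z) * exp (\<kappa> * (Re z - a))" for z
    by (simp add: g_def norm_mult)
  have \<kappa>b: "exp (\<kappa> * (b - a)) = A / B"
    using ab AB by (simp add: \<kappa>_def)
  have "norm (g s) \<le> A"
  proof (rule strip_maximum_modulus[OF _ ab(1) AB(1) _ _ _ s])
    show "g holomorphic_on half_plane 0"
      unfolding g_def by (intro holomorphic_intros hol)
    show "norm (g z) \<le> A" if "Re z = a" for z
      using bda[OF that] that by (simp add: norm_g)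
    show "norm (g z) \<le> A" if "Re z = b" for z
      using mult_right_mono[OF bdb[OF that], of "A / B"] that AB by (simp add: norm_g \<kappa>b)
    show "norm (g z) \<le> M * exp (\<bar>\<kappa>\<bar> * (b - a))" if "a \<le> Re z" "Re z \<le> b" for z
    proof -
      have "\<kappa> * (Re z - a) \<le> \<bar>\<kappa>\<bar> * (b - a)"
        using that by (intro mult_mono) auto
      then show ?thesis unfolding norm_g
        using bdd[OF that] order_trans[OF norm_ge_zero bdd[OF that]] by (intro mult_mono) auto
    qed
  qed
  then have "norm (f s) \<le> A * exp (- (\<kappa> * (Re s - a)))"
    by (simp add: norm_g exp_minus pos_le_divide_eq flip: divide_inverse)
  also have "exp (- (\<kappa> * (Re s - a))) = (B / A) powr ((Re s - a) / (b - a))"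
    using AB by (simp add: powr_def \<kappa>_def ln_div diff_divide_distrib algebra_simps)
  finally show ?thesis .
qed

text \<open>Smallness far to the right spreads to the left. Since \<open>\<delta>\<close> is
  independent of the function, one choice serves a whole sequence bounded by
  \<open>M\<close>.\<close>

lemma three_lines_small:
  assumes "0 < a" "a < c" "c < b" "0 < M" "0 < e"
  obtains \<delta> where "\<delta> > 0"
    and "\<And>f s. f holomorphic_on half_plane 0 \<Longrightarrow> (\<And>z. Re z \<ge> a \<Longrightarrow> norm (f z) \<le> M) \<Longrightarrow>
           (\<And>z. Re z \<ge> b \<Longrightarrow> norm (f z) \<le> \<delta>) \<Longrightarrow> Re s \<ge> c \<Longrightarrow> norm (f s) \<le> e"
proof -
  define l where "l = (c - a) / (b - a)"
  have l: "l > 0" using assms by (simp add: l_def)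
  \<comment> \<open>The last entry solves \<open>M * (\<delta> / M) powr l = e\<close> on the line
    \<open>Re s = c\<close>. The bound \<open>\<delta> \<le> M\<close> makes the power decreasing in
    its exponent, and \<open>\<delta> \<le> e\<close> settles \<open>Re s \<ge> b\<close>.\<close>
  define \<delta> where "\<delta> = min (min e M) (M * (e / M) powr (1 / l))"
  have \<delta>: "\<delta> > 0" "\<delta> \<le> e" "\<delta> \<le> M" "\<delta> / M \<le> (e / M) powr (1 / l)"
    using assms by (auto simp: \<delta>_def field_simps)
  show thesis
  proof (rule that[OF \<delta>(1)])
    fix f s assume hol: "f holomorphic_on half_plane 0"
      and M: "\<And>z. Re z \<ge> a \<Longrightarrow> norm (f z) \<le> M"
      and d: "\<And>z. Re z \<ge> b \<Longrightarrow> norm (f z) \<le> \<delta>" and s: "Re s \<ge> c"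
    show "norm (f s) \<le> e"
    proof (cases "Re s \<ge> b")
      case True
      then show ?thesis using d[OF True] \<delta> by linarith
    next
      case False
      have "norm (f s) \<le> M * (\<delta> / M) powr ((Re s - a) / (b - a))"
        by (rule hadamard_three_lines[OF hol]) (use assms s False M d \<delta> in auto)
      also have "(\<delta> / M) powr ((Re s - a) / (b - a)) \<le> (\<delta> / M) powr l"
        using \<delta> assms s by (intro powr_mono') (auto simp: l_def divide_right_mono)
      also have "\<dots> \<le> ((e / M) powr (1 / l)) powr l"
        using \<delta> assms l by (intro powr_mono2) auto
      also have "\<dots> = e / M"
        using l assms by (simp add: powr_powr)
      finally show ?thesis using assms by simp
    qed
  qed
qed

text \<open>Three lines theorem on \<open>a \<le> Re s \<le> b\<close> with the global bound on the
  right line; as \<open>b\<close> tends to infinity its exponent tends to 0 and only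
  \<open>A\<close> remains.\<close>

lemma phragmen_lindelof_half_plane:
  assumes hol: "f holomorphic_on half_plane 0" and a: "0 < a" and A: "0 < A"
    and bdd: "\<And>s. Re s \<ge> a \<Longrightarrow> norm (f s) \<le> M"
    and bda: "\<And>s. Re s = a \<Longrightarrow> norm (f s) \<le> A"
    and s: "Re s \<ge> a"
  shows "norm (f s) \<le> A"
proof -
  define M' where "M' = max M 1"
  have M': "M' > 0" "\<And>s. Re s \<ge> a \<Longrightarrow> norm (f s) \<le> M'"
    using bdd by (auto simp: M'_def intro: order_trans le_max_iff_disj[THEN iffD2])
  have "((\<lambda>b. A * (M' / A) powr ((Re s - a) / (b - a))) \<longlongrightarrow> A * (M' / A) powr 0) at_top"
  proof (intro tendsto_intros)
    show "((\<lambda>b. (Re s - a) / (b - a)) \<longlongrightarrow> 0) at_top" by real_asymp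
  qed (use A M' in auto)
  moreover have "eventually (\<lambda>b. norm (f s) \<le> A * (M' / A) powr ((Re s - a) / (b - a))) at_top"
    using eventually_gt_at_top[of "max a (Re s)"]
    by eventually_elim (rule hadamard_three_lines[OF hol], use a A M' bda s in auto)
  ultimately have "norm (f s) \<le> A * (M' / A) powr 0"
    by (intro tendsto_lowerbound) auto
  then show ?thesis using A M' by simp
qed

section \<open>Dirichlet series\<close>

text \<open>Indices are shifted: \<open>dterm n s\<close> is \<open>(n + 1)\<close> to the power \<open>- s\<close>, so that \<open>b 0\<close> is the constant coefficient.\<close>

definition dterm :: "nat \<Rightarrow> complex \<Rightarrow> complex" where
  "dterm n s = of_nat (Suc n) powr (- s)"

lemma dterm_exp: "dterm n s = exp (- s * of_real (ln (real (Suc n))))"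
  by (simp add: dterm_def powr_def Ln_of_nat del: of_nat_Suc)

lemma norm_dterm: "norm (dterm n s) = real (Suc n) powr (- Re s)"
  by (simp add: dterm_exp powr_def del: of_nat_Suc)

lemma norm_dterm_le: "a \<le> Re s \<Longrightarrow> norm (dterm n s) \<le> real (Suc n) powr (- a)"
  unfolding norm_dterm by (intro powr_mono) auto

lemma norm_dterm_le_1: "0 \<le> Re s \<Longrightarrow> norm (dterm n s) \<le> 1"
  using norm_dterm_le[of 0 s n] by simp

lemma dterm_0 [simp]: "dterm 0 s = 1"
  by (simp add: dterm_exp)

lemma dterm_shift:
  "dterm n (s + \<i> * of_real t) = cis (- t * ln (real (Suc n))) * dterm n s"
  by (simp add: dterm_exp cis_conv_exp algebra_simps flip: exp_add del: of_nat_Suc)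

lemma holomorphic_dterm [holomorphic_intros]: "dterm n holomorphic_on S"
  unfolding dterm_exp[abs_def] by (intro holomorphic_intros)

section \<open>Absolutely convergent Dirichlet series\<close>

definition abs_dirichlet :: "(nat \<Rightarrow> complex) \<Rightarrow> real \<Rightarrow> (complex \<Rightarrow> complex) \<Rightarrow> bool" where
  "abs_dirichlet b \<theta> f \<longleftrightarrow> summable (\<lambda>n. norm (b n) * real (Suc n) powr (- \<theta>)) \<and>
     (\<forall>s. Re s \<ge> \<theta> \<longrightarrow> f s = (\<Sum>n. b n * dterm n s))"

lemma norm_dirichlet_term_le:
  "\<theta> \<le> Re s \<Longrightarrow> norm (b * dterm n s) \<le> norm b * real (Suc n) powr (- \<theta>)"
  unfolding norm_mult by (intro mult_left_mono norm_dterm_le norm_ge_zero)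

lemma abs_dirichletD:
  assumes "abs_dirichlet b \<theta> f"
  shows "summable (\<lambda>n. norm (b n) * real (Suc n) powr (- \<theta>))"
    and "\<theta> \<le> Re s \<Longrightarrow> f s = (\<Sum>n. b n * dterm n s)"
  using assms unfolding abs_dirichlet_def by blast+

lemma abs_dirichlet_sums:
  assumes "abs_dirichlet b \<theta> f" "\<theta> \<le> Re s"
  shows "(\<lambda>n. b n * dterm n s) sums f s"
proof -
  have "summable (\<lambda>n. b n * dterm n s)"
    by (rule summable_comparison_test'[OF abs_dirichletD(1)[OF assms(1)]])
      (rule norm_dirichlet_term_le[OF assms(2)])
  then show ?thesis
    unfolding abs_dirichletD(2)[OF assms] by (rule summable_sums)
qed

lemma abs_dirichlet_norm_bound:
  assumes "abs_dirichlet b \<theta> f" "\<theta> \<le> Re s"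
  shows "norm (f s) \<le> (\<Sum>n. norm (b n) * real (Suc n) powr (- \<theta>))"
  unfolding abs_dirichletD(2)[OF assms]
  by (rule norm_suminf_le[OF norm_dirichlet_term_le[OF assms(2)] abs_dirichletD(1)[OF assms(1)]])

lemma summable_Suc_powr: "a > 1 \<Longrightarrow> summable (\<lambda>n. real (Suc n) powr (- a))"
  using summable_real_powr_iff[of "- a"] summable_Suc_iff[of "\<lambda>n. real n powr (- a)"] by simp

text \<open>Convergence at one point bounds the terms there; two units further right they are
  dominated by a multiple of \<open>real (Suc n) powr (- 2)\<close>.\<close>

lemma dirichlet_class_imp_abs_dirichlet:
  assumes "f \<in> dirichlet_class"
  obtains b \<theta> where "\<theta> > 0" "abs_dirichlet b \<theta> f"
proof -
  obtain a :: "nat \<Rightarrow> complex" and \<theta> where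
    sums: "\<And>s. Re s > \<theta> \<Longrightarrow> (\<lambda>n. a (Suc n) * of_nat (Suc n) powr (- s)) sums f s"
    using assms unfolding dirichlet_class_def half_plane_def by blast
  define b where "b = (\<lambda>n. a (Suc n))"
  define y where "y = max \<theta> 0 + 1"
  have sums': "(\<lambda>n. b n * dterm n s) sums f s" if "Re s > \<theta>" for s
    using sums[OF that] by (simp add: b_def dterm_def)
  have "(\<lambda>n. b n * dterm n (of_real y)) \<longlonglongrightarrow> 0"
    using sums'[of "of_real y"] by (intro summable_LIMSEQ_zero) (auto simp: y_def sums_iff)
  then have "Bseq (\<lambda>n. b n * dterm n (of_real y))"
    using convergentI convergent_imp_Bseq by blast
  then obtain M where M: "\<And>n. norm (b n * dterm n (of_real y)) \<le> M"
    by (auto simp: Bseq_def)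
  have "summable (\<lambda>n. norm (b n) * real (Suc n) powr (- (y + 2)))"
  proof (rule summable_comparison_test')
    show "summable (\<lambda>n. M * real (Suc n) powr (- 2))"
      by (intro summable_mult summable_Suc_powr) auto
    fix n
    have "norm (norm (b n) * real (Suc n) powr (- (y + 2))) =
        norm (b n * dterm n (of_real y)) * real (Suc n) powr (- 2)"
      by (simp add: norm_mult norm_dterm mult.assoc flip: powr_add del: of_nat_Suc)
    then show "norm (norm (b n) * real (Suc n) powr (- (y + 2))) \<le> M * real (Suc n) powr (- 2)"
      using M by (simp add: mult_right_mono del: of_nat_Suc)
  qed
  moreover have "f s = (\<Sum>n. b n * dterm n s)" if "Re s \<ge> y + 2" for s
    using sums'[of s] that by (simp add: y_def sums_iff)
  ultimately show thesis
    by (intro that[of "y + 2" b]) (auto simp: abs_dirichlet_def y_def)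
qed

lemma abs_dirichlet_imp_dirichlet_class:
  assumes "f holomorphic_on half_plane 0" "abs_dirichlet b \<theta> f"
  shows "f \<in> dirichlet_class"
proof -
  have "(\<lambda>n. b (Suc n - 1) * of_nat (Suc n) powr (- s)) sums f s" if "s \<in> half_plane \<theta>" for s
    using abs_dirichlet_sums[OF assms(2), of s] that by (simp add: dterm_def)
  then show ?thesis
    unfolding dirichlet_class_def using assms(1) by (intro CollectI conjI exI[of _ "\<lambda>n. b (n - 1)"] exI[of _ \<theta>] ballI)
qed

lemma tannery_0:
  fixes a :: "nat \<Rightarrow> nat \<Rightarrow> real"
  assumes "\<And>k. a k \<longlonglongrightarrow> 0" "\<And>k n. norm (a k n) \<le> M k" "summable M"
  shows "(\<lambda>n. \<Sum>k. a k n) \<longlonglongrightarrow> 0"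
proof -
  have "(\<lambda>n. \<Sum>k. a k n) \<longlonglongrightarrow> (\<Sum>k. 0)"
    using tannerys_theorem[of a "\<lambda>_. 0" sequentially M, OF assms(1) _ assms(3)] assms(2)
    by (simp add: always_eventually case_prod_beta)
  then show ?thesis by simp
qed

text \<open>The series is a locally uniform limit of holomorphic sums on
  \<open>Re s > \<sigma>\<close> and agrees with \<open>f\<close> far to the right, so the identity
  theorem gives equality throughout.\<close>

lemma abs_dirichlet_continuation:
  assumes hol: "f holomorphic_on half_plane 0" and f: "abs_dirichlet b \<theta> f"
    and \<sigma>: "\<sigma> > 0" "summable (\<lambda>n. norm (b n) * real (Suc n) powr (- \<sigma>))"
    and s: "Re s > \<sigma>"
  shows "f s = (\<Sum>n. b n * dterm n s)"
proof -
  define g where "g = (\<lambda>s. \<Sum>n. b n * dterm n s)"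
  have ul: "uniform_limit (half_plane \<sigma>) (\<lambda>N s. \<Sum>n<N. b n * dterm n s) g sequentially"
    unfolding g_def by (rule Weierstrass_m_test[OF norm_dirichlet_term_le \<sigma>(2)]) auto
  have "g holomorphic_on half_plane \<sigma>"
  proof (rule holomorphic_uniform_sequence[where f = "\<lambda>N s. \<Sum>n<N. b n * dterm n s"])
    fix x assume x: "x \<in> half_plane \<sigma>"
    then obtain d where "d > 0" "cball x d \<subseteq> half_plane \<sigma>"
      using open_half_plane open_contains_cball by blast
    then show "\<exists>d>0. cball x d \<subseteq> half_plane \<sigma> \<and>
        uniform_limit (cball x d) (\<lambda>N s. \<Sum>n<N. b n * dterm n s) g sequentially"
      using uniform_limit_on_subset[OF ul] by blast
  qed (intro open_half_plane holomorphic_intros)+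
  moreover have "f holomorphic_on half_plane \<sigma>"
    using \<sigma> by (intro holomorphic_on_subset[OF hol]) (auto simp: half_plane_def)
  ultimately have holfg: "(\<lambda>s. f s - g s) holomorphic_on half_plane \<sigma>"
    by (intro holomorphic_intros)
  define U where "U = half_plane (max \<sigma> \<theta>)"
  define p where "p = complex_of_real (max \<sigma> \<theta> + 1)"
  have "p \<in> U" "open U" by (auto simp: U_def p_def open_half_plane)
  then have "p islimpt U"
    by (simp add: interior_limit_point interior_open)
  have "f s - g s = 0"
  proof (rule analytic_continuation[OF holfg open_half_plane])
    show "connected (half_plane \<sigma>)" by (intro convex_connected convex_half_plane)
    show "U \<subseteq> half_plane \<sigma>" "p \<in> half_plane \<sigma>" by (auto simp: U_def p_def)
    show "p islimpt U" by fact
    show "f z - g z = 0" if "z \<in> U" for z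
      using f that by (auto simp: U_def g_def abs_dirichlet_def)
    show "s \<in> half_plane \<sigma>" using s by simp
  qed
  then show ?thesis by (simp add: g_def)
qed

section \<open>Averages of vertical translates\<close>

text \<open>Each pair of distinct integers excludes only countably many \<open>\<tau>\<close>. For
  the remaining ones the numbers \<open>cis (\<tau> * ln (real a))\<close> are pairwise
  distinct.\<close>

lemma exists_generic_shift:
  obtains \<tau> :: real
  where "\<And>a b :: nat. 0 < a \<Longrightarrow> 0 < b \<Longrightarrow> cis (\<tau> * (ln (real a) - ln (real b))) = 1 \<Longrightarrow> a = b"
proof -
  define h where "h = (\<lambda>(a :: nat, b :: nat, n :: int). of_int n * 2 * pi / (ln (real a) - ln (real b)))"
  have "countable (range h)" by simp
  then have "range h \<noteq> UNIV"
    using uncountable_UNIV_real by metis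
  then obtain \<tau> where \<tau>: "\<tau> \<notin> range h"
    by blast
  show thesis
  proof (rule that[of \<tau>], rule ccontr)
    fix a b :: nat assume ab: "0 < a" "0 < b" "a \<noteq> b"
      and *: "cis (\<tau> * (ln (real a) - ln (real b))) = 1"
    have "cos (\<tau> * (ln (real a) - ln (real b))) = 1"
      using arg_cong[OF *, of Re] by simp
    then obtain n :: int where n: "\<tau> * (ln (real a) - ln (real b)) = of_int n * 2 * pi"
      unfolding cos_one_2pi_int by blast
    have "ln (real a) - ln (real b) \<noteq> 0" using ab by simp
    with n have "\<tau> = h (a, b, n)" unfolding h_def by (simp add: eq_divide_eq)
    with \<tau> show False by blast
  qed
qed

definition avg :: "nat \<Rightarrow> complex \<Rightarrow> complex" where
  "avg J w = (\<Sum>j<J. w ^ j) / of_nat J"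

lemma norm_avg_le: "norm w = 1 \<Longrightarrow> norm (avg J w) \<le> 1"
proof -
  assume w: "norm w = 1"
  have "norm (\<Sum>j<J. w ^ j) \<le> real J"
    using sum_norm_le[of "{..<J}" "\<lambda>j. w ^ j" "\<lambda>_. 1"] w by (simp add: norm_power)
  then show ?thesis by (cases "J = 0") (simp_all add: avg_def norm_divide divide_le_eq_1)
qed

text \<open>For \<open>w \<noteq> 1\<close> on the unit circle the geometric sums stay bounded by
  \<open>2 / norm (w - 1)\<close>, so the Cesaro mean detects whether \<open>w\<close> is 1.\<close>

lemma avg_LIMSEQ:
  assumes w: "norm w = 1"
  shows "(\<lambda>J. avg J w) \<longlonglongrightarrow> (if w = 1 then 1 else 0)"
proof (cases "w = 1")
  case True
  have "eventually (\<lambda>J. avg J w = 1) sequentially"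
    using eventually_gt_at_top[of 0] by eventually_elim (simp add: True avg_def)
  then show ?thesis using True by (simp add: tendsto_eventually)
next
  case False
  have "norm (avg J w) \<le> (2 / norm (w - 1)) * inverse (real J)" for J
  proof -
    have "avg J w = (w ^ J - 1) / (w - 1) / of_nat J"
      unfolding avg_def using geometric_sum[OF False] by simp
    then have "norm (avg J w) = norm (w ^ J - 1) / norm (w - 1) * inverse (real J)"
      by (simp add: norm_divide norm_mult norm_inverse divide_inverse)
    also have "\<dots> \<le> 2 / norm (w - 1) * inverse (real J)"
      using norm_triangle_ineq4[of "w ^ J" 1] w
      by (intro mult_right_mono divide_right_mono) (auto simp: norm_power)
    finally show ?thesis .
  qed
  moreover have "(\<lambda>J. (2 / norm (w - 1)) * inverse (real J)) \<longlonglongrightarrow> 0"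
    by (rule tendsto_mult_right_zero[OF lim_inverse_n])
  ultimately have "(\<lambda>J. avg J w) \<longlonglongrightarrow> 0"
    by (rule Lim_null_comparison[OF always_eventually[OF allI]])
  then show ?thesis using False by simp
qed

text \<open>
  The weights \<open>1 + Re (\<beta> * u ^ j)\<close> are nonnegative, so averaging vertical translates against them keeps
  the real part nonnegative. With \<open>u = (k + 1) powr (\<i> * \<tau>)\<close> and \<open>\<tau>\<close> generic, only the constant and the
  \<open>k\<close>-th term survive in the limit.
\<close>
lemma positive_average:
  assumes hol: "f holomorphic_on half_plane 0" and pos: "\<And>s. Re s > 0 \<Longrightarrow> Re (f s) \<ge> 0"
    and f: "abs_dirichlet b \<theta> f" and k: "k > 0" and \<beta>: "norm \<beta> = 1"
  obtains W :: "nat \<Rightarrow> complex \<Rightarrow> complex" and E :: "nat \<Rightarrow> real"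
  where "\<And>J. W J holomorphic_on half_plane 0" "\<And>J s. Re s > 0 \<Longrightarrow> Re (W J s) \<ge> 0"
    "E \<longlonglongrightarrow> 0"
    "\<And>J s. Re s \<ge> \<theta> \<Longrightarrow> norm (W J s - (b 0 + \<beta> / 2 * b k * dterm k s)) \<le> E J"
proof -
  obtain \<tau> where \<tau>: "\<And>x y :: nat. 0 < x \<Longrightarrow> 0 < y \<Longrightarrow>
      cis (\<tau> * (ln (real x) - ln (real y))) = 1 \<Longrightarrow> x = y"
    using exists_generic_shift by blast
  \<comment> \<open>Translation by \<open>j * \<tau>\<close> multiplies the \<open>m\<close>-th term
    by \<open>v m ^ j\<close>; the power \<open>u ^ j\<close> in the weight compensates this factor
    exactly for \<open>m = k\<close>.\<close>
  define u where "u = cis (\<tau> * ln (real (Suc k)))"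
  define v where "v = (\<lambda>m. cis (- \<tau> * ln (real (Suc m))))"
  define w where "w = (\<lambda>j. 1 + Re (\<beta> * u ^ j))"
  define W where "W = (\<lambda>J s. (\<Sum>j<J. of_real (w j) * f (s + \<i> * of_real (real j * \<tau>))) / of_nat J)"
  \<comment> \<open>\<open>\<gamma> m J\<close> is the factor that averaging puts on the
    \<open>m\<close>-th term, split along
    \<open>w j = 1 + \<beta> / 2 * u ^ j + cnj \<beta> / 2 * cnj u ^ j\<close>; \<open>l m\<close>
    is its limit.\<close>
  define \<gamma> where "\<gamma> = (\<lambda>m J. avg J (v m) + \<beta> / 2 * avg J (u * v m) + cnj \<beta> / 2 * avg J (cnj u * v m))"
  define l where "l = (\<lambda>m. (if m = 0 then 1 else 0) + \<beta> / 2 * (if m = k then 1 else 0) :: complex)"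
  define E where "E = (\<lambda>J. \<Sum>m. norm (\<gamma> m J - l m) * (norm (b m) * real (Suc m) powr (- \<theta>)))"
  have nu: "norm u = 1" and nv: "norm (v m) = 1" for m by (simp_all add: u_def v_def)
  have w: "complex_of_real (w j) = 1 + \<beta> / 2 * u ^ j + cnj \<beta> / 2 * cnj u ^ j" for j
    using complex_add_cnj[of "\<beta> * u ^ j"] by (simp add: w_def field_simps)
  have w_nonneg: "w j \<ge> 0" for j
    using abs_Re_le_cmod[of "\<beta> * u ^ j"] nu \<beta> by (simp add: w_def norm_mult norm_power)
  have \<gamma>: "(\<Sum>j<J. of_real (w j) * v m ^ j) / of_nat J = \<gamma> m J" for m J
  proof -
    have "of_real (w j) * v m ^ j =
        v m ^ j + \<beta> / 2 * (u * v m) ^ j + cnj \<beta> / 2 * (cnj u * v m) ^ j" for j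
      unfolding w power_mult_distrib by algebra
    then show ?thesis
      by (simp only: \<gamma>_def avg_def sum.distrib add_divide_distrib times_divide_eq_right flip: sum_distrib_left)
  qed
  have cis_eq_1: "cis (\<tau> * (ln (real (Suc x)) - ln (real (Suc y)))) = 1 \<longleftrightarrow> x = y" for x y
  proof
    assume "cis (\<tau> * (ln (real (Suc x)) - ln (real (Suc y)))) = 1"
    from \<tau>[OF zero_less_Suc zero_less_Suc this] show "x = y" by (rule Suc_inject)
  qed (simp only: diff_self mult_zero_right cis_zero)
  have "v m = cis (\<tau> * (ln (real (Suc 0)) - ln (real (Suc m))))" for m
    by (simp add: v_def)
  then have v1: "v m = 1 \<longleftrightarrow> m = 0" for m
    using cis_eq_1[of 0 m] by (metis (no_types))
  have "u * v m = cis (\<tau> * (ln (real (Suc k)) - ln (real (Suc m))))" for m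
    unfolding u_def v_def cis_mult by (rule arg_cong[of _ _ cis]) algebra
  then have v2: "u * v m = 1 \<longleftrightarrow> m = k" for m
    using cis_eq_1[of k m] by (metis (no_types))
  \<comment> \<open>The phase belongs to the product \<open>(k + 1) * (m + 1)\<close>, which exceeds
    1 because \<open>k > 0\<close>; genericity then keeps it away from 1, so the conjugate part of
    the weight contributes nothing in the limit.\<close>
  have "cnj u * v m = cis (\<tau> * (ln (real (Suc 0)) - ln (real (Suc (k + m + k * m)))))" for m
  proof -
    have "real (Suc (k + m + k * m)) = real (Suc k) * real (Suc m)"
      by (simp add: algebra_simps)
    then have "ln (real (Suc (k + m + k * m))) = ln (real (Suc k)) + ln (real (Suc m))"
      by (simp only: ln_mult_pos of_nat_0_less_iff zero_less_Suc)
    then have "- (\<tau> * ln (real (Suc k))) + - \<tau> * ln (real (Suc m)) =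
        \<tau> * (ln (real (Suc 0)) - ln (real (Suc (k + m + k * m))))"
      by (simp only:) (simp add: algebra_simps del: of_nat_Suc)
    then show ?thesis
      unfolding u_def v_def cis_cnj cis_mult by (rule arg_cong)
  qed
  then have v3: "cnj u * v m \<noteq> 1" for m
    using cis_eq_1[of 0 "k + m + k * m"] k by (metis (no_types) add_is_0 less_irrefl)
  have \<gamma>_lim: "(\<lambda>J. \<gamma> m J) \<longlonglongrightarrow> l m" for m
  proof -
    have "(\<lambda>J. \<gamma> m J) \<longlonglongrightarrow> (if v m = 1 then 1 else 0) + \<beta> / 2 * (if u * v m = 1 then 1 else 0)
        + cnj \<beta> / 2 * (if cnj u * v m = 1 then 1 else 0)"
      unfolding \<gamma>_def by (intro tendsto_intros avg_LIMSEQ) (simp_all add: norm_mult nu nv)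
    then show ?thesis by (simp add: l_def v1 v2 v3)
  qed
  \<comment> \<open>A bound uniform in \<open>m\<close> and \<open>J\<close>, providing the summable
    majorant for \<open>E\<close>.\<close>
  have \<gamma>_bound: "norm (\<gamma> m J - l m) \<le> 4" for m J
  proof -
    have "norm (\<gamma> m J) \<le> 1 + 1 / 2 * 1 + 1 / 2 * 1"
      unfolding \<gamma>_def
      by (intro norm_triangle_le add_mono norm_mult_ineq[THEN order_trans] mult_mono norm_avg_le)
        (simp_all add: norm_mult nu nv \<beta> norm_divide)
    moreover have "norm (l m) \<le> 1 + 1 / 2"
      unfolding l_def by (intro norm_triangle_le add_mono) (auto simp: \<beta> norm_divide)
    ultimately show ?thesis using norm_triangle_ineq4[of "\<gamma> m J" "l m"] by linarith
  qed
  have E_le: "norm (norm (\<gamma> m J - l m) * (norm (b m) * real (Suc m) powr (- \<theta>)))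
      \<le> 4 * (norm (b m) * real (Suc m) powr (- \<theta>))" for m J
    unfolding real_norm_def abs_mult abs_norm_cancel abs_of_nonneg[OF powr_ge_zero]
    by (intro mult_right_mono \<gamma>_bound) auto
  note sum4 = summable_mult[OF abs_dirichletD(1)[OF f], of 4]
  show thesis
  proof (rule that[of W E])
    show "W J holomorphic_on half_plane 0" for J
      unfolding W_def divide_inverse
      by (intro holomorphic_intros holomorphic_on_compose_gen[OF _ hol, unfolded o_def])
        auto
    show "Re (W J s) \<ge> 0" if "Re s > 0" for J s
    proof -
      have "W J s = (\<Sum>j<J. of_real (w j) * f (s + \<i> * of_real (real j * \<tau>))) / of_real (real J)"
        by (simp add: W_def)
      also have "Re \<dots> = (\<Sum>j<J. w j * Re (f (s + \<i> * of_real (real j * \<tau>)))) / real J"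
        by (simp add: Re_divide_of_real del: of_real_of_nat_eq)
      also have "\<dots> \<ge> 0"
        using w_nonneg pos that by (intro divide_nonneg_nonneg sum_nonneg mult_nonneg_nonneg) auto
      finally show ?thesis .
    qed
    show "E \<longlonglongrightarrow> 0"
      unfolding E_def
    proof (rule tannery_0[OF _ E_le sum4])
      fix m
      have "(\<lambda>J. norm (\<gamma> m J - l m)) \<longlonglongrightarrow> 0"
        using \<gamma>_lim[of m] by (simp add: LIM_zero tendsto_norm_zero)
      then show "(\<lambda>J. norm (\<gamma> m J - l m) * (norm (b m) * real (Suc m) powr (- \<theta>))) \<longlonglongrightarrow> 0"
        by (rule tendsto_mult_left_zero)
    qed
    fix J s assume s: "Re s \<ge> \<theta>"
    have W_sums: "(\<lambda>m. \<gamma> m J * (b m * dterm m s)) sums W J s"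
    proof -
      have "(\<lambda>m. \<Sum>j<J. of_real (w j) * (b m * dterm m (s + \<i> * of_real (real j * \<tau>))))
          sums (\<Sum>j<J. of_real (w j) * f (s + \<i> * of_real (real j * \<tau>)))"
        using s by (intro sums_sum sums_mult abs_dirichlet_sums[OF f]) simp
      then have "(\<lambda>m. (\<Sum>j<J. of_real (w j) * (b m * dterm m (s + \<i> * of_real (real j * \<tau>)))) / of_nat J)
          sums W J s"
        unfolding W_def by (rule sums_divide)
      moreover have "(\<Sum>j<J. of_real (w j) * (b m * dterm m (s + \<i> * of_real (real j * \<tau>)))) / of_nat J
          = \<gamma> m J * (b m * dterm m s)" for m
      proof -
        have "dterm m (s + \<i> * of_real (real j * \<tau>)) = v m ^ j * dterm m s" for j
          unfolding dterm_shift by (simp add: v_def Complex.DeMoivre mult.assoc del: of_nat_Suc)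
        then have "(\<Sum>j<J. of_real (w j) * (b m * dterm m (s + \<i> * of_real (real j * \<tau>)))) =
            (\<Sum>j<J. of_real (w j) * v m ^ j * (b m * dterm m s))"
          by (simp only: mult_ac)
        then show ?thesis
          by (simp only: times_divide_eq_left flip: \<gamma> sum_distrib_right)
      qed
      ultimately show ?thesis by (simp only:)
    qed
    have L_sums: "(\<lambda>m. l m * (b m * dterm m s)) sums (b 0 + \<beta> / 2 * b k * dterm k s)"
    proof -
      have "(\<lambda>m. l m * (b m * dterm m s)) sums (\<Sum>m\<in>{0, k}. l m * (b m * dterm m s))"
        by (rule sums_finite) (auto simp: l_def)
      then show ?thesis using k by (simp add: l_def mult.assoc)
    qed
    have "W J s - (b 0 + \<beta> / 2 * b k * dterm k s) = (\<Sum>m. (\<gamma> m J - l m) * (b m * dterm m s))"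
      using sums_diff[OF W_sums L_sums] by (simp add: left_diff_distrib sums_iff)
    also have "norm \<dots> \<le> E J"
      unfolding E_def
    proof (rule norm_suminf_le)
      show "norm ((\<gamma> m J - l m) * (b m * dterm m s)) \<le>
          norm (\<gamma> m J - l m) * (norm (b m) * real (Suc m) powr (- \<theta>))" for m
        unfolding norm_mult[of "\<gamma> m J - l m"]
        by (intro mult_left_mono norm_dirichlet_term_le[OF s] norm_ge_zero)
      show "summable (\<lambda>m. norm (\<gamma> m J - l m) * (norm (b m) * real (Suc m) powr (- \<theta>)))"
        by (rule summable_comparison_test'[OF sum4 E_le])
    qed
    finally show "norm (W J s - (b 0 + \<beta> / 2 * b k * dterm k s)) \<le> E J" .
  qed
qed

section \<open>Dirichlet series with nonnegative real part\<close>

text \<open>Termwise comparison of the exponential series without their constant terms.\<close>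

lemma norm_exp_minus_1_le: "norm (exp z - 1) \<le> exp (norm z) - 1"
  for z :: "'a::{real_normed_field,banach}"
proof -
  have *: "(\<lambda>n. x ^ Suc n /\<^sub>R fact (Suc n)) sums (exp x - 1)" for x :: "'b::{real_normed_field,banach}"
    using sums_split_initial_segment[OF exp_converges[of x], of 1] by simp
  have "norm (\<Sum>n. z ^ Suc n /\<^sub>R fact (Suc n)) \<le> (\<Sum>n. norm z ^ Suc n /\<^sub>R fact (Suc n))"
    using *[of "norm z"]
    by (intro norm_suminf_le) (auto simp: norm_power norm_mult sums_iff simp del: power_Suc fact_Suc)
  then show ?thesis
    using *[of z] *[of "norm z"] by (simp add: sums_iff del: power_Suc fact_Suc)
qed

text \<open>
  The averages approximate \<open>b 0 + \<beta> / 2 * b k * dterm k s\<close> only far to the right. Passing to \<open>exp (- f)\<close>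
  makes everything bounded, and the three lines theorem moves the approximation up to the boundary.
\<close>
lemma coefficient_bound_point:
  assumes hol: "f holomorphic_on half_plane 0" and pos: "\<And>s. Re s > 0 \<Longrightarrow> Re (f s) \<ge> 0"
    and f: "abs_dirichlet b \<theta> f" and k: "k > 0" and \<beta>: "norm \<beta> = 1" and s: "Re s > 0"
  shows "Re (b 0 + \<beta> / 2 * b k * dterm k s) \<ge> 0"
proof (rule ccontr)
  define L where "L = (\<lambda>z. b 0 + \<beta> / 2 * b k * dterm k z)"
  define K where "K = exp (norm (b 0) + norm (b k))"
  assume "\<not> Re (b 0 + \<beta> / 2 * b k * dterm k s) \<ge> 0"
  \<comment> \<open>A negative real part of \<open>L s\<close> gives
    \<open>norm (exp (- L s)) > 1\<close>, whereas \<open>norm (exp (- W J s)) \<le> 1\<close>. The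
    contradiction comes from bringing the two exponentials within half of this excess.\<close>
  then have neg: "norm (exp (- L s)) > 1"
    by (simp only: L_def norm_exp_eq_Re uminus_complex.sel one_less_exp_iff not_le neg_0_less_iff_less)
  obtain W E where W: "\<And>J. W J holomorphic_on half_plane 0" "\<And>J s. Re s > 0 \<Longrightarrow> Re (W J s) \<ge> 0"
    and E: "E \<longlonglongrightarrow> (0 :: real)" "\<And>J s. Re s \<ge> \<theta> \<Longrightarrow> norm (W J s - L s) \<le> E J"
    using positive_average[OF hol pos f k \<beta>] unfolding L_def by metis
  have K: "K > 0" by (simp add: K_def)
  have L: "norm (exp (- L z)) \<le> K" if "Re z \<ge> 0" for z
  proof -
    have "norm (L z) \<le> norm (b 0) + norm (\<beta> / 2 * b k) * norm (dterm k z)"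
      unfolding L_def by (metis norm_triangle_ineq norm_mult)
    also have "norm (\<beta> / 2 * b k) * norm (dterm k z) \<le> norm (b k) * 1"
      using norm_dterm_le_1[OF that, of k] by (intro mult_mono) (auto simp: norm_mult norm_divide \<beta>)
    finally have "norm (- L z) \<le> norm (b 0) + norm (b k)" by simp
    then show ?thesis unfolding K_def by (intro order_trans[OF norm_exp]) simp
  qed
  obtain \<delta> where \<delta>: "\<delta> > 0" and small: "\<And>f z. f holomorphic_on half_plane 0 \<Longrightarrow>
      (\<And>z. Re z \<ge> Re s / 2 \<Longrightarrow> norm (f z) \<le> 1 + K) \<Longrightarrow>
      (\<And>z. Re z \<ge> max \<theta> (Re s + 1) \<Longrightarrow> norm (f z) \<le> \<delta>) \<Longrightarrow> Re z \<ge> Re s \<Longrightarrow>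
      norm (f z) \<le> (norm (exp (- L s)) - 1) / 2"
    using three_lines_small[of "Re s / 2" "Re s" "max \<theta> (Re s + 1)" "1 + K"
        "(norm (exp (- L s)) - 1) / 2"] s K neg by (auto simp: less_max_iff_disj)
  have "(\<lambda>J. K * (exp (E J) - 1)) \<longlonglongrightarrow> K * (exp 0 - 1)"
    by (intro tendsto_intros E)
  then have "eventually (\<lambda>J. K * (exp (E J) - 1) < \<delta>) sequentially"
    using \<delta> by (intro order_tendstoD(2)) auto
  then obtain J where J: "K * (exp (E J) - 1) < \<delta>"
    using eventually_happens trivial_limit_sequentially by blast
  have W1: "norm (exp (- W J z)) \<le> 1" if "Re z > 0" for z
    using W(2)[OF that] by simp
  have "norm (exp (- W J s) - exp (- L s)) \<le> (norm (exp (- L s)) - 1) / 2"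
  proof (rule small[of "\<lambda>z. exp (- W J z) - exp (- L z)"])
    show "(\<lambda>z. exp (- W J z) - exp (- L z)) holomorphic_on half_plane 0"
      unfolding L_def by (intro holomorphic_intros W(1))
    show "norm (exp (- W J z) - exp (- L z)) \<le> 1 + K" if "Re s / 2 \<le> Re z" for z
      using W1[of z] L[of z] that s norm_triangle_ineq4[of "exp (- W J z)" "exp (- L z)"] by linarith
    show "norm (exp (- W J z) - exp (- L z)) \<le> \<delta>" if z: "max \<theta> (Re s + 1) \<le> Re z" for z
    proof -
      \<comment> \<open>Factoring out \<open>exp (- L z)\<close>, which is bounded by
        \<open>K\<close>, leaves an error controlled by \<open>E J\<close>.\<close>
      have "exp (- W J z) - exp (- L z) = exp (- L z) * (exp (- (W J z - L z)) - 1)"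
        by (simp add: algebra_simps flip: exp_add)
      also have "norm \<dots> \<le> K * (exp (norm (- (W J z - L z))) - 1)"
        unfolding norm_mult using z s K
        by (intro mult_mono L norm_exp_minus_1_le) auto
      also have "\<dots> \<le> K * (exp (E J) - 1)"
        using E(2)[of z J] z K by (simp only: norm_minus_cancel mult_le_cancel_left_pos) simp
      finally show ?thesis using J by linarith
    qed
  qed simp
  then show False
    using W1[OF s] neg norm_triangle_ineq2[of "exp (- L s)" "exp (- W J s)"]
      norm_minus_commute[of "exp (- L s)" "exp (- W J s)"] by argo
qed

text \<open>The phase \<open>\<beta>\<close> is chosen so that
  \<open>\<beta> * b k = - norm (b k)\<close>. The pointwise inequality at real
  \<open>\<sigma>\<close> then yields the bound as \<open>\<sigma>\<close> decreases to 0.\<close>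

lemma coefficient_bound:
  assumes hol: "f holomorphic_on half_plane 0" and pos: "\<And>s. Re s > 0 \<Longrightarrow> Re (f s) \<ge> 0"
    and f: "abs_dirichlet b \<theta> f" and k: "k > 0"
  shows "norm (b k) \<le> 2 * Re (b 0)"
proof -
  \<comment> \<open>The value 1 for a vanishing coefficient only keeps \<open>\<beta>\<close> on the
    unit circle.\<close>
  define \<beta> where "\<beta> = (if b k = 0 then 1 else - cnj (sgn (b k)))"
  have \<beta>: "norm \<beta> = 1" "\<beta> * b k = - of_real (norm (b k))"
    using complex_norm_square[of "b k"]
    by (auto simp: \<beta>_def norm_sgn sgn_eq norm_divide field_simps power2_eq_square)
  have *: "norm (b k) * real (Suc k) powr (- \<sigma>) \<le> 2 * Re (b 0)" if "\<sigma> > 0" for \<sigma>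
  proof -
    have "dterm k (of_real \<sigma>) = of_real (real (Suc k) powr (- \<sigma>))"
      by (simp add: dterm_exp powr_def exp_of_real[symmetric] del: of_nat_Suc exp_of_real)
    then have "b 0 + \<beta> / 2 * b k * dterm k (of_real \<sigma>) =
        b 0 + of_real (- (norm (b k) * real (Suc k) powr (- \<sigma>) / 2))"
      using \<beta>(2) by (simp add: field_simps del: of_nat_Suc)
    then have "Re (b 0 + \<beta> / 2 * b k * dterm k (of_real \<sigma>)) =
        Re (b 0) - norm (b k) * real (Suc k) powr (- \<sigma>) / 2"
      by (simp del: of_nat_Suc)
    then show ?thesis
      using coefficient_bound_point[OF hol pos f k \<beta>(1), of "of_real \<sigma>"] that by simp
  qed
  have "((\<lambda>\<sigma>. norm (b k) * real (Suc k) powr (- \<sigma>)) \<longlongrightarrow> norm (b k) * real (Suc k) powr (- 0)) (at_right 0)"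
    by (intro tendsto_intros) auto
  then have "norm (b k) * real (Suc k) powr (- 0) \<le> 2 * Re (b 0)"
    using * by (intro tendsto_upperbound) (auto intro!: eventually_at_rightI[of 0 1] simp del: of_nat_Suc)
  then show ?thesis by simp
qed

section \<open>Bounds by the value at 4\<close>

text \<open>Equality is allowed so that the condition passes to limits and covers the zero series,
  which belongs to \<open>\<Phi> s = s\<close>.\<close>

definition positive_dirichlet :: "(complex \<Rightarrow> complex) \<Rightarrow> bool" where
  "positive_dirichlet f \<longleftrightarrow> f \<in> dirichlet_class \<and> (\<forall>s. Re s > 0 \<longrightarrow> Re (f s) \<ge> 0)"

lemma positive_dirichletD:
  assumes "positive_dirichlet f"
  shows "f \<in> dirichlet_class" "f holomorphic_on half_plane 0" "\<And>s. Re s > 0 \<Longrightarrow> Re (f s) \<ge> 0"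
  using assms by (auto simp: positive_dirichlet_def dirichlet_class_def)

text \<open>Comparison with a telescoping series. The constant \<open>1 / 4\<close> makes the tail
  of a series with coefficients at most \<open>2 * Re (b 0)\<close> no larger than
  \<open>Re (b 0) / 2\<close>.\<close>

lemma tail_4_le:
  "summable (\<lambda>n. real (Suc (Suc n)) powr (- 4))" "(\<Sum>n. real (Suc (Suc n)) powr (- 4)) \<le> 1 / 4"
proof -
  have "(\<lambda>n. inverse (real (Suc n)) - inverse (real (Suc (Suc n)))) sums (inverse (real (Suc 0)) - 0)"
    using telescope_sums'[OF LIMSEQ_inverse_real_of_nat] by simp
  from sums_mult[OF this, of "1 / 4"]
  have *: "(\<lambda>n. 1 / 4 * (inverse (real (Suc n)) - inverse (real (Suc (Suc n))))) sums (1 / 4)" by simp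
  have le: "real (Suc (Suc n)) powr (- 4) \<le> 1 / 4 * (inverse (real (Suc n)) - inverse (real (Suc (Suc n))))" for n
  proof -
    define x where "x = real n"
    have x: "x \<ge> 0" by (simp add: x_def)
    \<comment> \<open>Factor by factor: \<open>4 \<le> (x + 2) ^ 2\<close> and
      \<open>(x + 1) * (x + 2) \<le> (x + 2) ^ 2\<close>.\<close>
    have "4 * ((x + 1) * (x + 2)) \<le> (x + 2) ^ 2 * (x + 2) ^ 2"
      using x by (intro mult_mono) (auto simp: power2_eq_square algebra_simps)
    then have "1 / (x + 2) ^ 4 \<le> 1 / (4 * ((x + 1) * (x + 2)))"
      using x by (intro divide_left_mono) (auto simp flip: power_add)
    moreover have "1 / (4 * ((x + 1) * (x + 2))) = 1 / 4 * (inverse (x + 1) - inverse (x + 2))"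
      using x by (simp add: field_simps)
    moreover have "(x + 2) powr (- 4) = 1 / (x + 2) ^ 4"
      using x by (simp add: powr_minus_divide powr_numeral)
    moreover have "real (Suc n) = x + 1" "real (Suc (Suc n)) = x + 2" by (simp_all add: x_def)
    ultimately show ?thesis by (simp only:)
  qed
  show "summable (\<lambda>n. real (Suc (Suc n)) powr (- 4))"
    using summable_Suc_powr[of 4] summable_Suc_iff[of "\<lambda>n. real (Suc n) powr (- 4)"] by simp
  then show "(\<Sum>n. real (Suc (Suc n)) powr (- 4)) \<le> 1 / 4"
    using suminf_le[OF le _ sums_summable[OF *]] sums_unique[OF *] by simp
qed

text \<open>On \<open>Re s \<ge> 4\<close> the nonconstant terms sum to at most
  \<open>Re (b 0) / 2\<close>. At \<open>s = 4\<close> they therefore cannot cancel the constant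
  one, so \<open>norm (f 4)\<close> controls \<open>b 0\<close> and through it all
  coefficients.\<close>

lemma positive_dirichlet_coefficients:
  assumes "positive_dirichlet f"
  obtains b where "abs_dirichlet b 4 f" "\<And>k. norm (b k) \<le> 4 * norm (f 4)"
    "\<And>s. Re s \<ge> 4 \<Longrightarrow> norm (f s) \<le> 3 * norm (f 4)"
proof -
  note hol = positive_dirichletD(2)[OF assms] and pos = positive_dirichletD(3)[OF assms]
  obtain b \<theta> where b: "abs_dirichlet b \<theta> f"
    using dirichlet_class_imp_abs_dirichlet[OF positive_dirichletD(1)[OF assms]] by blast
  have bound: "norm (b k) \<le> 2 * Re (b 0)" if "k > 0" for k
    by (rule coefficient_bound[OF hol pos b that])
  have Re0: "Re (b 0) \<ge> 0" using bound[of 1] norm_ge_zero[of "b 1"] by linarith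
  have sm: "summable (\<lambda>n. norm (b n) * real (Suc n) powr (- \<sigma>))" if "\<sigma> > 1" for \<sigma>
  proof (rule summable_comparison_test')
    show "summable (\<lambda>n. max (norm (b 0)) (2 * Re (b 0)) * real (Suc n) powr (- \<sigma>))"
      by (intro summable_mult summable_Suc_powr that)
    fix n
    have "norm (b n) \<le> max (norm (b 0)) (2 * Re (b 0))"
      using bound[of n] by (cases "n = 0") auto
    then show "norm (norm (b n) * real (Suc n) powr (- \<sigma>)) \<le> max (norm (b 0)) (2 * Re (b 0)) * real (Suc n) powr (- \<sigma>)"
      unfolding real_norm_def abs_mult abs_norm_cancel abs_of_nonneg[OF powr_ge_zero]
      by (intro mult_right_mono) auto
  qed
  \<comment> \<open>Continuation needs an abscissa strictly below 4 and above 1, for which 2 is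
    taken.\<close>
  have b4: "abs_dirichlet b 4 f"
    unfolding abs_dirichlet_def using sm[of 4] abs_dirichlet_continuation[OF hol b _ sm[of 2]] by simp
  have diff: "norm (f s - b 0) \<le> Re (b 0) / 2" if s: "Re s \<ge> 4" for s
  proof -
    have "(\<lambda>n. b (Suc n) * dterm (Suc n) s) sums (f s - b 0)"
      using abs_dirichlet_sums[OF b4 s] by (subst sums_Suc_iff) simp
    then have "norm (f s - b 0) = norm (\<Sum>n. b (Suc n) * dterm (Suc n) s)"
      by (simp add: sums_iff)
    also have "\<dots> \<le> (\<Sum>n. 2 * Re (b 0) * real (Suc (Suc n)) powr (- 4))"
    proof (rule norm_suminf_le)
      show "norm (b (Suc n) * dterm (Suc n) s) \<le> 2 * Re (b 0) * real (Suc (Suc n)) powr (- 4)" for n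
        using bound[of "Suc n"] norm_dterm_le[OF s, of "Suc n"] Re0 unfolding norm_mult
        by (intro mult_mono) auto
      show "summable (\<lambda>n. 2 * Re (b 0) * real (Suc (Suc n)) powr (- 4))"
        by (intro summable_mult tail_4_le)
    qed
    also have "\<dots> = 2 * Re (b 0) * (\<Sum>n. real (Suc (Suc n)) powr (- 4))"
      by (rule suminf_mult[OF tail_4_le(1)])
    also have "\<dots> \<le> 2 * Re (b 0) * (1 / 4)"
      using Re0 by (intro mult_left_mono tail_4_le) auto
    finally show ?thesis by simp
  qed
  have le4: "Re (b 0) \<le> 2 * norm (f 4)"
    using diff[of 4] abs_Re_le_cmod[of "f 4 - b 0"] complex_Re_le_cmod[of "f 4"] by auto
  have b0: "norm (b 0) \<le> 2 * norm (f 4)"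
    using diff[of 4] le4 norm_triangle_ineq2[of "b 0" "f 4"] by (simp add: norm_minus_commute)
  show thesis
  proof (rule that[OF b4])
    show "norm (b k) \<le> 4 * norm (f 4)" for k
    proof (cases "k = 0")
      case True
      show ?thesis unfolding True using b0 norm_ge_zero[of "f 4"] by linarith
    next
      case False
      then show ?thesis using bound[of k] le4 by linarith
    qed
    show "norm (f s) \<le> 3 * norm (f 4)" if "Re s \<ge> 4" for s
      using diff[OF that] le4 b0 norm_triangle_ineq2[of "f s" "b 0"] by linarith
  qed
qed

text \<open>A Harnack-type estimate: the Schwarz lemma for the Cayley transform of
  \<open>f + 1\<close>. Adding 1 keeps the real part at least 1, so the transform maps strictly into
  the unit disc even where \<open>Re (f s) = 0\<close>.\<close>

lemma positive_real_part_growth: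
  assumes hol: "f holomorphic_on half_plane 0" and pos: "\<And>s. Re s > 0 \<Longrightarrow> Re (f s) \<ge> 0"
    and s: "0 < Re s" "Re s \<le> R"
  shows "norm (f s + 1) \<le> 2 * R / Re s * norm (f (Complex R (Im s)) + 1)"
proof -
  have R: "R > 0" using s by linarith
  \<comment> \<open>The disc of radius \<open>R\<close> about \<open>Complex R (Im s)\<close>,
    tangent to the imaginary axis, is rescaled to the unit disc; \<open>s\<close> corresponds to the
    point \<open>\<xi>\<close> below.\<close>
  define g where "g = (\<lambda>z. f (Complex R (Im s) + of_real R * z) + 1)"
  define p where "p = g 0"
  define w where "w = (\<lambda>z. (g z - p) / (g z + cnj p))"
  have inside: "Re (Complex R (Im s) + of_real R * z) > 0" if "norm z < 1" for z
  proof -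
    have "R * (- Re z) < R * 1"
      using that abs_Re_le_cmod[of z] R by (intro mult_strict_left_mono) auto
    then show ?thesis by simp
  qed
  have Re_g: "Re (g z) \<ge> 1" if "norm z < 1" for z
    using pos[OF inside[OF that]] by (simp add: g_def)
  have Re_p: "Re p \<ge> 1" unfolding p_def by (rule Re_g) simp
  have denom: "g z + cnj p \<noteq> 0" if "norm z < 1" for z
  proof
    assume "g z + cnj p = 0"
    then have "Re (g z) + Re p = 0" by (metis complex_cnj(1) plus_complex.sel(1) zero_complex.sel(1) cnj.sel(1))
    then show False using Re_g[OF that] Re_p by linarith
  qed
  have hol_g: "g holomorphic_on ball 0 1"
    unfolding g_def using inside
    by (intro holomorphic_intros holomorphic_on_compose_gen[OF _ hol, unfolded o_def]) auto
  have w_lt: "norm (w z) < 1" if z: "norm z < 1" for z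
  proof -
    have "Re (g z) * Re p > 0" using Re_g[OF z] Re_p by (intro mult_pos_pos) linarith+
    then have "norm (g z - p) < norm (g z + cnj p)"
      unfolding cmod_def real_sqrt_less_iff by (simp add: power2_eq_square algebra_simps)
    then show ?thesis
      using denom[OF z] by (simp add: w_def norm_divide divide_less_eq)
  qed
  define r where "r = 1 - Re s / R"
  define \<xi> where "\<xi> = - complex_of_real r"
  have "0 \<le> r" "r < 1"
    using s R by (simp_all add: r_def)
  then have r: "norm \<xi> = r" "0 \<le> r" "r < 1"
    by (simp_all add: \<xi>_def)
  have g\<xi>: "g \<xi> = f s + 1"
  proof -
    have "Complex R (Im s) + of_real R * \<xi> = s"
      using R by (simp add: complex_eq_iff \<xi>_def r_def right_diff_distrib)
    then show ?thesis by (simp add: g_def)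
  qed
  have "norm (w \<xi>) \<le> r"
    unfolding r(1)[symmetric]
  proof (rule Schwarz_Lemma(1))
    show "w holomorphic_on ball 0 1"
      unfolding w_def using denom by (intro holomorphic_intros hol_g) auto
  qed (use w_lt r in \<open>auto simp: w_def p_def\<close>)
  have "g \<xi> - p = w \<xi> * (g \<xi> + cnj p)"
    using denom[of \<xi>] r by (simp add: w_def)
  \<comment> \<open>Solving for \<open>norm (g \<xi>)\<close> gives the factor
    \<open>(1 + r) / (1 - r)\<close>, where \<open>1 - r = Re s / R\<close>.\<close>
  then have "norm (g \<xi> - p) \<le> r * (norm (g \<xi>) + norm p)"
    using \<open>norm (w \<xi>) \<le> r\<close> norm_triangle_ineq[of "g \<xi>" "cnj p"] r(2)
    by (metis complex_mod_cnj mult_mono norm_ge_zero norm_mult)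
  then have "norm (g \<xi>) \<le> norm p + r * (norm (g \<xi>) + norm p)"
    using norm_triangle_ineq2[of "g \<xi>" p] by linarith
  then have "norm (g \<xi>) * (Re s / R) \<le> norm p * (1 + r)"
    by (simp add: r_def algebra_simps)
  also have "\<dots> \<le> norm p * 2"
    using r by (intro mult_left_mono) auto
  finally have "norm (g \<xi>) \<le> 2 * R / Re s * norm p"
    using s R by (simp add: field_simps)
  then show ?thesis unfolding g\<xi> by (simp add: p_def g_def)
qed

text \<open>To the left of \<open>Re s = 4\<close> the growth estimate with \<open>R = 4\<close>
  compares \<open>f s\<close> with the value at the same height on that line, where
  \<open>3 * norm (f 4)\<close> is a bound.\<close>

lemma positive_dirichlet_bound:
  assumes f: "positive_dirichlet f" and \<epsilon>: "0 < \<epsilon>" "\<epsilon> \<le> 4" and s: "Re s \<ge> \<epsilon>"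
  shows "norm (f s) \<le> 8 / \<epsilon> * (3 * norm (f 4) + 1) + 1"
proof -
  have far: "norm (f s) \<le> 3 * norm (f 4)" if "Re s \<ge> 4" for s
    using positive_dirichlet_coefficients[OF f] that by metis
  show ?thesis
  proof (cases "Re s \<ge> 4")
    case True
    have "norm (f s) \<le> 1 * (3 * norm (f 4) + 1)"
      using far[OF True] by simp
    also have "\<dots> \<le> 8 / \<epsilon> * (3 * norm (f 4) + 1)"
      using \<epsilon> by (intro mult_right_mono) auto
    finally show ?thesis by simp
  next
    case False
    have "norm (f s + 1) \<le> 2 * 4 / Re s * norm (f (Complex 4 (Im s)) + 1)"
      using False s \<epsilon> by (intro positive_real_part_growth positive_dirichletD[OF f]) auto
    also have "\<dots> \<le> 8 / \<epsilon> * (3 * norm (f 4) + 1)"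
    proof (rule mult_mono)
      show "2 * 4 / Re s \<le> 8 / \<epsilon>" using s \<epsilon> by (simp add: divide_left_mono)
      show "norm (f (Complex 4 (Im s)) + 1) \<le> 3 * norm (f 4) + 1"
        using far[of "Complex 4 (Im s)"] norm_triangle_ineq[of "f (Complex 4 (Im s))" 1] by simp
    qed (use \<epsilon> in auto)
    finally show ?thesis
      using norm_triangle_ineq2[of "f s" "- 1"] by simp
  qed
qed

section \<open>Limits\<close>

text \<open>An approximation uniform in \<open>n\<close> transfers the Cauchy property, so that no
  limit has to be named; this serves both the coefficients and the characteristics.\<close>

lemma convergent_approx:
  fixes X :: "nat \<Rightarrow> 'a::{real_normed_vector,banach}"
  assumes "\<And>e. e > 0 \<Longrightarrow> \<exists>Y. convergent Y \<and> (\<forall>n. norm (X n - Y n) \<le> e)"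
  shows "convergent X"
  unfolding Cauchy_convergent_iff[symmetric]
proof (rule metric_CauchyI)
  fix e :: real assume e: "e > 0"
  obtain Y where Y: "convergent Y" "\<And>n. norm (X n - Y n) \<le> e / 4"
    using assms[of "e / 4"] e by auto
  obtain N where N: "\<And>m n. m \<ge> N \<Longrightarrow> n \<ge> N \<Longrightarrow> dist (Y m) (Y n) < e / 4"
    using metric_CauchyD[OF convergent_Cauchy[OF Y(1)], of "e / 4"] e by auto
  show "\<exists>N. \<forall>m\<ge>N. \<forall>n\<ge>N. dist (X m) (X n) < e"
  proof (intro exI allI impI)
    fix m n assume mn: "m \<ge> N" "n \<ge> N"
    have "X m - X n = (X m - Y m) + (Y m - Y n) - (X n - Y n)" by simp
    also have "norm \<dots> \<le> norm (X m - Y m) + norm (Y m - Y n) + norm (X n - Y n)"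
      by (meson norm_triangle_ineq norm_triangle_ineq4 order_trans add_mono order_refl)
    finally show "dist (X m) (X n) < e"
      using Y(2)[of m] Y(2)[of n] N[OF mn] e by (simp add: dist_norm)
  qed
qed

text \<open>
  The \<open>k\<close>-th coefficient is \<open>(f x - (\<Sum>j<k. b j * dterm j x)) / dterm k x\<close> up to an error that
  tends to \<open>0\<close> as \<open>x \<rightarrow> \<infinity>\<close>, uniformly over series with coefficients bounded by \<open>C\<close>.
\<close>
lemma dirichlet_coefficients_converge:
  assumes f: "\<And>n. abs_dirichlet (b n) 4 (f n)" and C: "\<And>n k. norm (b n k) \<le> C"
    and conv: "\<And>s. Re s \<ge> 4 \<Longrightarrow> convergent (\<lambda>n. f n s)"
  shows "convergent (\<lambda>n. b n k)"
proof (induction k rule: less_induct)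
  case (less k)
  \<comment> \<open>\<open>q m powr Re x\<close> is the ratio of the norms of
    \<open>dterm (m + Suc k) x\<close> and \<open>dterm k x\<close>. Thus \<open>C * T N\<close>
    bounds the error of the approximation at \<open>x = N + 4\<close>.\<close>
  define q where "q = (\<lambda>m. real (Suc k) / real (Suc (m + Suc k)))"
  define T where "T = (\<lambda>N::nat. \<Sum>m. q m powr (real N + 4))"
  have q: "0 < q m" "q m < 1" for m by (simp_all add: q_def del: of_nat_Suc)
  have q_le: "norm (q m powr (real N + 4)) \<le> q m powr 4" for m N
    unfolding real_norm_def abs_of_nonneg[OF powr_ge_zero]
    using q[of m] by (intro powr_mono') auto
  have sum_q: "summable (\<lambda>m. q m powr 4)"
  proof -
    have "summable (\<lambda>m. real (Suc k) powr 4 * real (Suc (m + Suc k)) powr (- 4))"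
      using summable_ignore_initial_segment[OF summable_Suc_powr[of 4], of "Suc k"]
      by (intro summable_mult) simp
    moreover have "q m powr 4 = real (Suc k) powr 4 * real (Suc (m + Suc k)) powr (- 4)" for m
      unfolding q_def by (simp only: powr_divide powr_minus of_nat_0_le_iff) (rule divide_inverse)
    ultimately show ?thesis by (simp only:)
  qed
  have "T \<longlonglongrightarrow> 0"
    unfolding T_def
  proof (rule tannery_0[OF _ q_le sum_q])
    fix m
    have "(\<lambda>N. q m powr 4 * q m ^ N) \<longlonglongrightarrow> q m powr 4 * 0"
      using q[of m] by (intro tendsto_intros LIMSEQ_realpow_zero) auto
    then show "(\<lambda>N. q m powr (real N + 4)) \<longlonglongrightarrow> 0"
      using q[of m] by (simp add: powr_add powr_realpow mult.commute)
  qed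
  then have CT: "(\<lambda>N. C * T N) \<longlonglongrightarrow> 0"
    by (rule tendsto_mult_right_zero)
  show "convergent (\<lambda>n. b n k)"
  proof (rule convergent_approx)
    fix e :: real assume "e > 0"
    then obtain N where N: "C * T N < e"
      using eventually_happens[OF order_tendstoD(2)[OF CT, of e]] by auto
    define x where "x = complex_of_real (real N + 4)"
    have x: "Re x \<ge> 4" by (simp add: x_def)
    \<comment> \<open>\<open>Y\<close> involves only \<open>f n x\<close> and earlier coefficients,
      so it converges by hypothesis and induction.\<close>
    define Y where "Y = (\<lambda>n. (f n x - (\<Sum>j<k. b n j * dterm j x)) / dterm k x)"
    have nz: "dterm k x \<noteq> 0" by (simp add: dterm_exp)
    have "convergent Y"
    proof -
      obtain l where "(\<lambda>n. f n x) \<longlonglongrightarrow> l" using conv[OF x] by (auto simp: convergent_def)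
      moreover have "\<forall>j\<in>{..<k}. \<exists>c. (\<lambda>n. b n j) \<longlonglongrightarrow> c"
        using less by (auto simp: convergent_def)
      then obtain c where "\<And>j. j \<in> {..<k} \<Longrightarrow> (\<lambda>n. b n j) \<longlonglongrightarrow> c j" by metis
      ultimately have "Y \<longlonglongrightarrow> (l - (\<Sum>j<k. c j * dterm j x)) / dterm k x"
        unfolding Y_def by (intro tendsto_intros nz) auto
      then show ?thesis by (rule convergentI)
    qed
    moreover have "norm (b n k - Y n) \<le> e" for n
    proof -
      have "(\<lambda>m. b n (m + Suc k) * dterm (m + Suc k) x / dterm k x) sums
          ((f n x - (\<Sum>j<Suc k. b n j * dterm j x)) / dterm k x)"
        by (intro sums_divide sums_split_initial_segment abs_dirichlet_sums[OF f x])
      moreover have "(f n x - (\<Sum>j<Suc k. b n j * dterm j x)) / dterm k x = Y n - b n k"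
        using nz by (simp add: Y_def field_simps)
      ultimately have "Y n - b n k = (\<Sum>m. b n (m + Suc k) * dterm (m + Suc k) x / dterm k x)"
        by (simp add: sums_iff)
      also have "norm \<dots> \<le> (\<Sum>m. C * q m powr (real N + 4))"
      proof (rule norm_suminf_le)
        fix m
        have "norm (dterm (m + Suc k) x) / norm (dterm k x) = q m powr (real N + 4)"
          unfolding norm_dterm x_def Re_complex_of_real powr_minus q_def
          by (simp only: powr_divide of_nat_0_le_iff) (simp add: divide_inverse mult.commute)
        then show "norm (b n (m + Suc k) * dterm (m + Suc k) x / dterm k x) \<le> C * q m powr (real N + 4)"
          using C[of n "m + Suc k"] by (simp add: norm_mult norm_divide mult_right_mono
              flip: times_divide_eq_right)
      qed (intro summable_mult summable_comparison_test'[OF sum_q q_le])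
      also have "\<dots> = C * T N"
        unfolding T_def by (intro suminf_mult summable_comparison_test'[OF sum_q q_le])
      finally show ?thesis using N by (simp add: norm_minus_commute)
    qed
    ultimately show "\<exists>Y. convergent Y \<and> (\<forall>n. norm (b n k - Y n) \<le> e)" by blast
  qed
qed

text \<open>Convergence at 4 bounds all coefficients uniformly in \<open>n\<close>. Their limits
  define a series \<open>h\<close> that is approached uniformly on \<open>Re s \<ge> 4\<close> by
  dominated convergence; it equals \<open>g\<close> there, and the three lines theorem extends the
  uniformity to the left.\<close>

lemma positive_dirichlet_limit:
  assumes f: "\<And>n. positive_dirichlet (f n)" and g: "g holomorphic_on half_plane 0"
    and lim: "\<And>s. Re s > 0 \<Longrightarrow> (\<lambda>n. f n s) \<longlonglongrightarrow> g s"
  shows "g \<in> dirichlet_class" and "\<epsilon> > 0 \<Longrightarrow> uniform_limit (half_plane \<epsilon>) f g sequentially"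
proof -
  have "Bseq (\<lambda>n. f n 4)"
    using lim[of 4] by (intro convergent_imp_Bseq convergentI) auto
  then obtain M where M: "\<And>n. norm (f n 4) \<le> M" by (auto simp: Bseq_def)
  have "\<forall>n. \<exists>b. abs_dirichlet b 4 (f n) \<and> (\<forall>k. norm (b k) \<le> 4 * norm (f n 4))"
    using positive_dirichlet_coefficients[OF f] by metis
  then obtain b where b: "\<And>n. abs_dirichlet (b n) 4 (f n)" "\<And>n k. norm (b n k) \<le> 4 * norm (f n 4)"
    by metis
  define C where "C = 4 * M"
  have C: "norm (b n k) \<le> C" for n k
    using b(2)[of n k] M[of n] by (simp add: C_def)
  have "convergent (\<lambda>n. b n k)" for k
  proof (rule dirichlet_coefficients_converge[OF b(1) C])
    show "convergent (\<lambda>n. f n s)" if "Re s \<ge> 4" for s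
      using lim[of s] that by (intro convergentI) auto
  qed
  then obtain c where c: "\<And>k. (\<lambda>n. b n k) \<longlonglongrightarrow> c k"
    unfolding convergent_def by metis
  have c_le: "norm (c k) \<le> C" for k
    using C by (intro tendsto_upperbound[OF tendsto_norm[OF c]]) auto
  have sumC: "summable (\<lambda>k. a * real (Suc k) powr (- 4))" for a
    by (intro summable_mult summable_Suc_powr) auto
  define E where "E = (\<lambda>n. \<Sum>k. norm (b n k - c k) * real (Suc k) powr (- 4))"
  have E_le: "norm (norm (b n k - c k) * real (Suc k) powr (- 4)) \<le> 2 * C * real (Suc k) powr (- 4)" for k n
    unfolding real_norm_def abs_mult abs_norm_cancel abs_of_nonneg[OF powr_ge_zero]
    using norm_triangle_ineq4[of "b n k" "c k"] C[of n k] c_le[of k] by (intro mult_right_mono) auto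
  have E: "E \<longlonglongrightarrow> 0"
    unfolding E_def
  proof (rule tannery_0[OF _ E_le sumC])
    fix k
    have "(\<lambda>n. norm (b n k - c k)) \<longlonglongrightarrow> 0"
      using c[of k] by (simp add: LIM_zero tendsto_norm_zero)
    then show "(\<lambda>n. norm (b n k - c k) * real (Suc k) powr (- 4)) \<longlonglongrightarrow> 0"
      by (rule tendsto_mult_left_zero)
  qed
  define h where "h = (\<lambda>s. \<Sum>k. c k * dterm k s)"
  have h: "abs_dirichlet c 4 h"
    unfolding abs_dirichlet_def h_def
  proof (intro conjI allI impI refl summable_comparison_test'[OF sumC])
    show "norm (norm (c k) * real (Suc k) powr (- 4)) \<le> C * real (Suc k) powr (- 4)" for k
      unfolding real_norm_def abs_mult abs_norm_cancel abs_of_nonneg[OF powr_ge_zero]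
      by (intro mult_right_mono c_le) auto
  qed
  have fh: "norm (f n s - h s) \<le> E n" if s: "Re s \<ge> 4" for n s
  proof -
    have "f n s - h s = (\<Sum>k. (b n k - c k) * dterm k s)"
      using sums_diff[OF abs_dirichlet_sums[OF b(1) s] abs_dirichlet_sums[OF h s]]
      by (simp add: left_diff_distrib sums_iff)
    also have "norm \<dots> \<le> E n"
      unfolding E_def
      by (intro norm_suminf_le norm_dirichlet_term_le[OF s] summable_comparison_test'[OF sumC E_le])
    finally show ?thesis .
  qed
  have gh: "g s = h s" if s: "Re s \<ge> 4" for s
  proof (rule LIMSEQ_unique)
    show "(\<lambda>n. f n s) \<longlonglongrightarrow> g s" using lim s by simp
    have "(\<lambda>n. f n s - h s) \<longlonglongrightarrow> 0"
      by (rule Lim_null_comparison[OF _ E]) (simp add: fh[OF s])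
    then show "(\<lambda>n. f n s) \<longlonglongrightarrow> h s" by (rule LIM_zero_cancel)
  qed
  show "g \<in> dirichlet_class"
    using h gh by (intro abs_dirichlet_imp_dirichlet_class[OF g, of c 4]) (auto simp: abs_dirichlet_def)
  assume \<epsilon>: "\<epsilon> > 0"
  \<comment> \<open>An auxiliary line strictly between 0 and \<open>\<epsilon>\<close>, and left of
    4, on whose right side all \<open>f n\<close> and \<open>g\<close> are bounded by
    \<open>B\<close>.\<close>
  define a where "a = min \<epsilon> 4 / 2"
  define B where "B = 8 / a * (3 * M + 1) + 1"
  have a: "0 < a" "a \<le> 4" "a < \<epsilon>" using \<epsilon> by (auto simp: a_def)
  have fB: "norm (f n s) \<le> B" if "Re s \<ge> a" for n s
  proof -
    have "8 / a * (3 * norm (f n 4) + 1) \<le> 8 / a * (3 * M + 1)"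
      using a M[of n] by (intro mult_left_mono) auto
    then show ?thesis
      using positive_dirichlet_bound[OF f a(1,2) that, of n] unfolding B_def by linarith
  qed
  have gB: "norm (g s) \<le> B" if "Re s \<ge> a" for s
    using fB[OF that] lim[of s] that a by (intro tendsto_upperbound[OF tendsto_norm]) auto
  have B: "B > 0"
    using order_trans[OF norm_ge_zero M[of 0]] a
    unfolding B_def by (intro add_nonneg_pos mult_nonneg_nonneg) auto
  show "uniform_limit (half_plane \<epsilon>) f g sequentially"
  proof (rule uniform_limitI)
    fix e :: real assume e: "e > 0"
    \<comment> \<open>The abscissa \<open>\<epsilon> + 4\<close> lies to the right of both
      \<open>\<epsilon>\<close> and 4, so the estimate by \<open>E n\<close> holds from there
      on.\<close>
    obtain \<delta> where \<delta>: "\<delta> > 0" and small: "\<And>f z. f holomorphic_on half_plane 0 \<Longrightarrow>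
        (\<And>z. Re z \<ge> a \<Longrightarrow> norm (f z) \<le> 2 * B) \<Longrightarrow>
        (\<And>z. Re z \<ge> \<epsilon> + 4 \<Longrightarrow> norm (f z) \<le> \<delta>) \<Longrightarrow> Re z \<ge> \<epsilon> \<Longrightarrow> norm (f z) \<le> e / 2"
      using three_lines_small[of a \<epsilon> "\<epsilon> + 4" "2 * B" "e / 2"] a B e by auto
    have "eventually (\<lambda>n. E n < \<delta>) sequentially"
      using E \<delta> by (rule order_tendstoD)
    then show "eventually (\<lambda>n. \<forall>s\<in>half_plane \<epsilon>. dist (f n s) (g s) < e) sequentially"
    proof eventually_elim
      case (elim n)
      show ?case
      proof
        fix s assume "s \<in> half_plane \<epsilon>"
        then have s: "Re s \<ge> \<epsilon>" by simp
        have "norm (f n s - g s) \<le> e / 2"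
        proof (rule small[of "\<lambda>z. f n z - g z", OF _ _ _ s])
          show "(\<lambda>z. f n z - g z) holomorphic_on half_plane 0"
            by (intro holomorphic_intros g positive_dirichletD[OF f])
          show "norm (f n z - g z) \<le> 2 * B" if "a \<le> Re z" for z
            using norm_triangle_ineq4[of "f n z" "g z"] fB[OF that, of n] gB[OF that] by linarith
          show "norm (f n z - g z) \<le> \<delta>" if "\<epsilon> + 4 \<le> Re z" for z
            using fh[of z n] gh[of z] that \<epsilon> elim by simp
        qed
        then show "dist (f n s) (g s) < e" using e by (simp add: dist_norm)
      qed
    qed
  qed
qed

section \<open>Characteristics and limits in \<open>G_infinity\<close>\<close>

lemma dirichlet_class_cong:
  assumes "f \<in> dirichlet_class" "\<And>s. Re s > 0 \<Longrightarrow> g s = f s"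
  shows "g \<in> dirichlet_class"
proof -
  obtain b \<theta> where b: "\<theta> > 0" "abs_dirichlet b \<theta> f"
    using dirichlet_class_imp_abs_dirichlet[OF assms(1)] by blast
  have "f holomorphic_on half_plane 0" using assms(1) by (simp add: dirichlet_class_def)
  then have "g holomorphic_on half_plane 0"
    by (rule holomorphic_transform) (use assms(2) in auto)
  then show ?thesis
    by (rule abs_dirichlet_imp_dirichlet_class)
      (use b assms(2) in \<open>auto simp: abs_dirichlet_def\<close>)
qed

lemma const_in_dirichlet_class: "(\<lambda>_. w) \<in> dirichlet_class"
proof (rule abs_dirichlet_imp_dirichlet_class)
  define b where "b = (\<lambda>k::nat. if k = 0 then w else 0)"
  have "(\<lambda>k. b k * dterm k s) sums w" for s
    using sums_finite[of "{0}" "\<lambda>k. b k * dterm k s"] by (simp add: b_def)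
  moreover have "summable (\<lambda>k. norm (b k) * real (Suc k) powr (- 1))"
    by (rule summable_finite[of "{0}"]) (auto simp: b_def)
  ultimately show "abs_dirichlet b 1 (\<lambda>_. w)"
    by (simp add: abs_dirichlet_def sums_iff)
qed simp

text \<open>
  Although \<open>\<Phi> s - c * s\<close> is only known to have real part greater than \<open>- c * Re s\<close>, on the line
  \<open>Re s = a\<close> this is \<open>- c * a\<close>, which propagates to the right and vanishes as \<open>a \<rightarrow> 0\<close>.
\<close>
lemma G_infinity_positive_dirichlet:
  assumes "\<Phi> \<in> G_infinity" and c: "has_characteristic \<Phi> c"
  shows "positive_dirichlet (\<lambda>s. \<Phi> s - of_nat c * s)"
proof -
  have \<Phi>: "Re (\<Phi> s) > 0" if "Re s > 0" for s
    using assms(1) that unfolding G_infinity_def by (metis (no_types, lifting) CollectD image_subset_iff mem_half_plane)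
  define f where "f = (\<lambda>s. \<Phi> s - of_nat c * s)"
  obtain \<phi> where \<phi>: "\<phi> \<in> dirichlet_class" "\<And>s. Re s > 0 \<Longrightarrow> \<Phi> s = of_nat c * s + \<phi> s"
    using c unfolding has_characteristic_def by auto
  have f: "f \<in> dirichlet_class"
    by (rule dirichlet_class_cong[OF \<phi>(1)]) (simp add: f_def \<phi>(2))
  then have hol: "f holomorphic_on half_plane 0" by (simp add: dirichlet_class_def)
  obtain b \<theta> where \<theta>: "\<theta> > 0" and b: "abs_dirichlet b \<theta> f"
    using dirichlet_class_imp_abs_dirichlet[OF f] by blast
  define K where "K = (\<Sum>n. norm (b n) * real (Suc n) powr (- \<theta>))"
  have lower: "Re (f s) \<ge> - (real c * Re s)" if "Re s > 0" for s
    using \<Phi>[OF that] by (simp add: f_def)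
  have "Re (f s) \<ge> 0" if s: "Re s > 0" for s
  proof -
    have "- Re (f s) \<le> 0 + e" if e: "e > 0" for e
    proof -
      \<comment> \<open>The line must lie to the left of \<open>s\<close> and satisfy
        \<open>c * a \<le> e\<close>; dividing by \<open>c + 1\<close> also covers
        \<open>c = 0\<close>.\<close>
      define a where "a = min (Re s) (e / (real c + 1))"
      have a: "0 < a" "a \<le> Re s" "a \<le> e / (real c + 1)" using s e by (auto simp: a_def)
      have "norm (exp (- f s)) \<le> exp (real c * a)"
      proof (rule phragmen_lindelof_half_plane[OF _ a(1) _ _ _ a(2)])
        show "(\<lambda>s. exp (- f s)) holomorphic_on half_plane 0"
          by (intro holomorphic_intros hol)
        show "norm (exp (- f z)) \<le> exp (real c * a)" if "Re z = a" for z
          using lower[of z] that a by simp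
        \<comment> \<open>Right of \<open>\<theta>\<close> absolute convergence bounds
          \<open>f\<close>; between \<open>a\<close> and \<open>\<theta>\<close> the lower bound for
          \<open>Re (f z)\<close> suffices.\<close>
        show "norm (exp (- f z)) \<le> exp (max K (real c * \<theta>))" if z: "Re z \<ge> a" for z
        proof (cases "Re z \<ge> \<theta>")
          case True
          have "- Re (f z) \<le> norm (f z)" using abs_Re_le_cmod[of "f z"] by linarith
          also have "\<dots> \<le> K" unfolding K_def by (rule abs_dirichlet_norm_bound[OF b True])
          finally show ?thesis by simp
        next
          case False
          then have "real c * Re z \<le> real c * \<theta>" by (intro mult_left_mono) auto
          then show ?thesis using lower[of z] z a by simp
        qed
      qed simp
      then have "- Re (f s) \<le> real c * a" by simp
      also have "\<dots> \<le> (real c + 1) * a" using a by (intro mult_right_mono) auto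
      also have "\<dots> \<le> e" using a(3) by (simp add: pos_le_divide_eq mult.commute add_pos_nonneg)
      finally show ?thesis by simp
    qed
    then have "- Re (f s) \<le> 0" by (rule field_le_epsilon)
    then show ?thesis by simp
  qed
  with f show ?thesis unfolding positive_dirichlet_def f_def by blast
qed

text \<open>Once the characteristics are constant, subtracting \<open>c * s\<close> reduces
  everything to Dirichlet series with nonnegative real part. The inequality
  \<open>Re (\<Phi> s) \<ge> real c * Re s\<close> is recorded because it forces
  \<open>c = 0\<close> when the limit is an imaginary constant.\<close>

lemma G_infinity_sequence_limit:
  assumes F: "\<And>n. F n \<in> G_infinity"
    and lim: "\<And>K. compact K \<Longrightarrow> K \<subseteq> half_plane 0 \<Longrightarrow> uniform_limit K F \<Phi> sequentially"
  obtains c where "has_characteristic \<Phi> c" "\<Phi> holomorphic_on half_plane 0"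
    "\<And>s. Re s > 0 \<Longrightarrow> Re (\<Phi> s) \<ge> real c * Re s"
    "eventually (\<lambda>n. characteristic (F n) = c) sequentially"
    "\<And>\<epsilon>. \<epsilon> > 0 \<Longrightarrow> uniform_limit (half_plane \<epsilon>) F \<Phi> sequentially"
proof -
  have ptw: "(\<lambda>n. F n s) \<longlonglongrightarrow> \<Phi> s" if "Re s > 0" for s
    using tendsto_uniform_limitI[OF lim[of "{s}"], of s] that by simp
  have hol: "\<Phi> holomorphic_on half_plane 0"
  proof (rule holomorphic_uniform_sequence[OF open_half_plane])
    show "F n holomorphic_on half_plane 0" for n using F[of n] by (simp add: G_infinity_def)
    fix x assume "x \<in> half_plane 0"
    then obtain d where "d > 0" "cball x d \<subseteq> half_plane 0"
      using open_half_plane open_contains_cball by blast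
    then show "\<exists>d>0. cball x d \<subseteq> half_plane 0 \<and> uniform_limit (cball x d) F \<Phi> sequentially"
      by (intro exI[of _ d] conjI lim compact_cball)
  qed
  define k where "k = (\<lambda>n. characteristic (F n))"
  have k: "has_characteristic (F n) (k n)" for n
  proof -
    obtain c where "has_characteristic (F n) c" using F[of n] by (auto simp: G_infinity_def)
    then show ?thesis unfolding k_def by (simp add: characteristic_eqI)
  qed
  define \<phi> where "\<phi> = (\<lambda>n s. F n s - of_nat (k n) * s)"
  have \<phi>: "positive_dirichlet (\<phi> n)" for n
    unfolding \<phi>_def by (rule G_infinity_positive_dirichlet[OF F k])
  have "Bseq (\<lambda>n. F n 1)" "Bseq (\<lambda>n. F n 4)"
    using ptw[of 1] ptw[of 4] by (auto intro!: convergent_imp_Bseq intro: convergentI)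
  then obtain M1 M4 where M: "\<And>n. norm (F n 1) \<le> M1" "\<And>n. norm (F n 4) \<le> M4"
    by (auto simp: Bseq_def)
  \<comment> \<open>Positivity of \<open>Re (\<phi> n 1)\<close> gives \<open>k n \<le> M1\<close>,
    hence \<open>norm (\<phi> n 4) \<le> M4 + 4 * M1\<close>; the factor 3 extends this to
    \<open>Re s \<ge> 4\<close>.\<close>
  define B where "B = 3 * (M4 + 4 * M1)"
  have B: "norm (\<phi> n s) \<le> B" if "Re s \<ge> 4" for n s
  proof -
    have "Re (\<phi> n 1) \<ge> 0" by (rule positive_dirichletD(3)[OF \<phi>]) simp
    then have "real (k n) \<le> M1"
      using complex_Re_le_cmod[of "F n 1"] M(1)[of n] by (simp add: \<phi>_def)
    moreover have "norm (\<phi> n 4) \<le> norm (F n 4) + norm (of_nat (k n) * 4 :: complex)"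
      unfolding \<phi>_def by (rule norm_triangle_ineq4)
    ultimately have "norm (\<phi> n 4) \<le> M4 + 4 * M1"
      using M(2)[of n] by (simp add: norm_mult)
    moreover have "norm (\<phi> n s) \<le> 3 * norm (\<phi> n 4)"
      using positive_dirichlet_coefficients[OF \<phi>] that by metis
    ultimately show ?thesis by (simp add: B_def)
  qed
  have "convergent (\<lambda>n. of_nat (k n) :: complex)"
  proof (rule convergent_approx)
    fix e :: real assume e: "e > 0"
    \<comment> \<open>Large enough that \<open>\<phi> n x / x\<close> is at most \<open>e\<close> in
      norm for every \<open>n\<close>.\<close>
    define x where "x = max 4 (B / e)"
    have x: "x \<ge> 4" "B \<le> e * x"
      using e by (auto simp: x_def field_simps max_def)
    have "convergent (\<lambda>n. F n (of_real x) / of_real x)"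
      using ptw[of "of_real x"] x by (intro convergentI[OF tendsto_divide[OF _ tendsto_const]]) auto
    moreover have "norm (of_nat (k n) - F n (of_real x) / of_real x) \<le> e" for n
    proof -
      have "of_nat (k n) - F n (of_real x) / of_real x = - (\<phi> n (of_real x) / of_real x)"
        using x by (simp add: \<phi>_def field_simps)
      then have "norm (of_nat (k n) - F n (of_real x) / of_real x) = norm (\<phi> n (of_real x)) / x"
        using x by (simp add: norm_divide)
      also have "\<dots> \<le> e"
        using B[of "of_real x" n] x by (simp add: divide_le_eq)
      finally show ?thesis .
    qed
    ultimately show "\<exists>Y. convergent Y \<and> (\<forall>n. norm (of_nat (k n) - Y n :: complex) \<le> e)" by blast
  qed
  then obtain N where N: "\<And>m n. m \<ge> N \<Longrightarrow> n \<ge> N \<Longrightarrow> dist (of_nat (k m) :: complex) (of_nat (k n)) < 1"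
    using metric_CauchyD[OF convergent_Cauchy zero_less_one] by blast
  define c where "c = k N"
  have kc: "k n = c" if "n \<ge> N" for n
  proof -
    have "norm (of_real (real (k n) - real c) :: complex) < 1"
      using N[OF that order_refl] by (simp add: dist_norm c_def)
    then have "\<bar>real (k n) - real c\<bar> < 1" by (simp only: norm_of_real)
    then show ?thesis by linarith
  qed
  \<comment> \<open>Dropping the first \<open>N\<close> terms makes the characteristic equal to
    \<open>c\<close> throughout, so that \<open>f n\<close> converges to \<open>g\<close>.\<close>
  define f where "f = (\<lambda>n. \<phi> (n + N))"
  define g where "g = (\<lambda>s. \<Phi> s - of_nat c * s)"
  have f_eq: "f n s = F (n + N) s - of_nat c * s" for n s
    by (simp add: f_def \<phi>_def kc)
  have f: "positive_dirichlet (f n)" for n unfolding f_def by (rule \<phi>)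
  have hol_g: "g holomorphic_on half_plane 0"
    unfolding g_def by (intro holomorphic_intros hol)
  have fg: "(\<lambda>n. f n s) \<longlonglongrightarrow> g s" if "Re s > 0" for s
    unfolding f_eq g_def by (intro tendsto_intros LIMSEQ_ignore_initial_segment ptw that)
  note limit = positive_dirichlet_limit[of f g, OF f hol_g fg]
  show thesis
  proof (rule that)
    show "has_characteristic \<Phi> c"
      unfolding has_characteristic_def using limit(1) by (intro bexI[of _ g]) (auto simp: g_def)
    show "Re (\<Phi> s) \<ge> real c * Re s" if s: "Re s > 0" for s
    proof -
      have "Re (g s) \<ge> 0"
        using positive_dirichletD(3)[OF f s]
        by (intro tendsto_lowerbound[OF tendsto_Re[OF fg[OF s]]]) auto
      then show ?thesis by (simp add: g_def)
    qed
    show "eventually (\<lambda>n. characteristic (F n) = c) sequentially"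
      using kc unfolding k_def eventually_sequentially by blast
    fix \<epsilon> :: real assume \<epsilon>: "\<epsilon> > 0"
    show "uniform_limit (half_plane \<epsilon>) F \<Phi> sequentially"
    proof (rule uniform_limitI)
      fix e :: real assume "e > 0"
      then have "eventually (\<lambda>n. \<forall>s\<in>half_plane \<epsilon>. dist (f n s) (g s) < e) sequentially"
        using limit(2)[OF _ \<epsilon>] by (auto simp: uniform_limit_iff)
      then have "eventually (\<lambda>n. \<forall>s\<in>half_plane \<epsilon>. dist (F (n + N) s) (\<Phi> s) < e) sequentially"
        by (simp add: f_eq g_def dist_norm)
      then show "eventually (\<lambda>n. \<forall>s\<in>half_plane \<epsilon>. dist (F n s) (\<Phi> s) < e) sequentially"
        by (rule eventually_sequentially_seg[THEN iffD1])
    qed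
  qed (rule hol)
qed

section \<open>The dichotomy and closedness\<close>

text \<open>If a value lies on the imaginary axis and the function is not constant, the open mapping
  theorem produces values with negative real part.\<close>

lemma nonneg_real_part_cases:
  assumes hol: "\<Phi> holomorphic_on half_plane 0" and pos: "\<And>s. Re s > 0 \<Longrightarrow> Re (\<Phi> s) \<ge> 0"
  shows "\<Phi> ` half_plane 0 \<subseteq> half_plane 0 \<or> \<Phi> \<in> imaginary_constants"
proof (cases "\<exists>s. Re s > 0 \<and> Re (\<Phi> s) = 0")
  case True
  then obtain s0 where s0: "Re s0 > 0" "Re (\<Phi> s0) = 0" by blast
  have "\<Phi> constant_on half_plane 0"
  proof (rule ccontr)
    assume "\<not> \<Phi> constant_on half_plane 0"
    then have "open (\<Phi> ` half_plane 0)"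
      by (intro open_mapping_thm[OF hol]) (auto simp: open_half_plane convex_connected convex_half_plane)
    then obtain r where r: "r > 0" "ball (\<Phi> s0) r \<subseteq> \<Phi> ` half_plane 0"
      using s0(1) by (metis imageI mem_half_plane open_contains_ball)
    have "\<Phi> s0 - of_real (r / 2) \<in> ball (\<Phi> s0) r"
      using r(1) by (simp add: dist_norm)
    then obtain s where "Re s > 0" "\<Phi> s = \<Phi> s0 - of_real (r / 2)"
      using r(2) by (metis imageE mem_half_plane subsetD)
    then show False using pos[of s] s0 r(1) by simp
  qed
  then obtain w where w: "\<And>s. Re s > 0 \<Longrightarrow> \<Phi> s = w" by (auto simp: constant_on_def)
  then have "w = \<i> * of_real (Im w)" using s0 by (simp add: complex_eq_iff)
  then have "\<Phi> \<in> imaginary_constants" using w unfolding imaginary_constants_def by auto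
  then show ?thesis ..
next
  case False
  then show ?thesis using pos by (auto simp: order_less_le)
qed

lemma positive_constant_in_G_infinity:
  assumes w: "Re w > 0" "\<And>s. Re s > 0 \<Longrightarrow> \<Phi> s = w"
  shows "\<Phi> \<in> G_infinity"
proof -
  have "has_characteristic \<Phi> 0"
    unfolding has_characteristic_def using w(2) by (intro bexI[OF _ const_in_dirichlet_class[of w]]) simp
  moreover have "\<Phi> holomorphic_on half_plane 0"
    by (rule holomorphic_transform[of "\<lambda>_. w"]) (simp_all add: w(2))
  ultimately show ?thesis using w by (auto simp: G_infinity_def)
qed

text \<open>Sequences suffice because countably many compact sets exhaust the half-plane: if every
  neighbourhood of \<open>f\<close> meets \<open>A\<close>, picking elements close to
  \<open>f\<close> on these sets gives a sequence in \<open>A\<close> converging to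
  \<open>f\<close>.\<close>

lemma closedin_compact_convergence_half_plane:
  fixes A :: "(complex \<Rightarrow> 'b::metric_space) set"
  assumes closed: "\<And>F f. (\<And>n. F n \<in> A) \<Longrightarrow>
    (\<And>K. compact K \<Longrightarrow> K \<subseteq> half_plane 0 \<Longrightarrow> uniform_limit K F f sequentially) \<Longrightarrow> f \<in> A"
  shows "closedin (compact_convergence_topology (half_plane 0)) A"
  unfolding closedin_def topspace_compact_convergence_topology openin_compact_convergence_topology
proof (intro conjI ballI subset_UNIV)
  fix f assume f: "f \<in> UNIV - A"
  \<comment> \<open>A compact exhaustion: a compact \<open>K\<close> with
    \<open>norm z \<le> R\<close> and \<open>d \<le> Re z\<close> lies in \<open>L n\<close> as soon
    as \<open>R \<le> n\<close> and \<open>1 / (n + 1) < d\<close>.\<close>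
  define L where "L = (\<lambda>n::nat. cball 0 (real n) \<inter> {s. Re s \<ge> inverse (real (Suc n))})"
  have L: "compact (L n)" "L n \<subseteq> half_plane 0" for n
  proof -
    show "compact (L n)"
      unfolding L_def by (intro compact_Int_closed compact_cball closed_halfspace_Re_ge)
    have "0 < inverse (real (Suc n))" by simp
    moreover have "inverse (real (Suc n)) \<le> Re z" if "z \<in> L n" for z
      using that unfolding L_def by blast
    ultimately show "L n \<subseteq> half_plane 0"
      unfolding subset_iff mem_half_plane by (meson less_le_trans)
  qed
  show "\<exists>K e. compact K \<and> K \<subseteq> half_plane 0 \<and> e > 0 \<and> {g. \<forall>z\<in>K. dist (g z) (f z) < e} \<subseteq> UNIV - A"
  proof (rule ccontr)
    assume contra: "\<not> ?thesis"
    have "\<exists>g. g \<in> A \<and> (\<forall>z\<in>L n. dist (g z) (f z) < inverse (real (Suc n)))" for n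
    proof -
      have "\<not> {g. \<forall>z\<in>L n. dist (g z) (f z) < inverse (real (Suc n))} \<subseteq> UNIV - A"
        using contra L[of n] inverse_Suc by blast
      then show ?thesis by blast
    qed
    then obtain F where F: "\<And>n. F n \<in> A" "\<And>n z. z \<in> L n \<Longrightarrow> dist (F n z) (f z) < inverse (real (Suc n))"
      by metis
    have "f \<in> A"
    proof (rule closed[of F, OF F(1)])
      fix K :: "complex set" assume K: "compact K" "K \<subseteq> half_plane 0"
      obtain R where R: "\<And>z. z \<in> K \<Longrightarrow> norm z \<le> R"
        using compact_imp_bounded[OF K(1)] by (auto simp: bounded_iff)
      obtain d where d: "d > 0" "\<And>z. z \<in> K \<Longrightarrow> d \<le> Re z"
      proof (cases "K = {}")
        case False
        then obtain z where "z \<in> K" "\<And>w. w \<in> K \<Longrightarrow> Re z \<le> Re w"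
          using continuous_attains_inf[OF K(1) False continuous_on_Re[OF continuous_on_id]] by blast
        then show ?thesis using that[of "Re z"] K(2) by auto
      qed (use that[of 1] in auto)
      have small: "eventually (\<lambda>n. inverse (real (Suc n)) < e) sequentially" if "e > 0" for e
        using LIMSEQ_inverse_real_of_nat that by (rule order_tendstoD)
      show "uniform_limit K F f sequentially"
      proof (rule uniform_limitI)
        fix e :: real assume "e > 0"
        from small[OF this] small[OF d(1)] eventually_ge_at_top[of "nat \<lceil>R\<rceil>"]
        show "eventually (\<lambda>n. \<forall>z\<in>K. dist (F n z) (f z) < e) sequentially"
        proof eventually_elim
          case (elim n)
          have "z \<in> L n" if "z \<in> K" for z
            using R[OF that] d(2)[OF that] elim by (auto simp: L_def nat_le_iff ceiling_le_iff simp del: of_nat_Suc)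
          then show ?case using F(2) elim(1) less_trans by blast
        qed
      qed
    qed
    then show False using f by blast
  qed
qed

theorem theorem4p2:
  shows "(\<forall>(F :: nat \<Rightarrow> complex \<Rightarrow> complex) (\<Phi> :: complex \<Rightarrow> complex).
            (\<forall>n. F n \<in> G_infinity) \<longrightarrow>
            (\<forall>K. compact K \<and> K \<subseteq> half_plane 0 \<longrightarrow> uniform_limit K F \<Phi> sequentially) \<longrightarrow>
              (\<forall>\<epsilon>>0. uniform_limit (half_plane \<epsilon>) F \<Phi> sequentially) \<and>
              (\<Phi> \<in> G_infinity \<or> \<Phi> \<in> imaginary_constants) \<and>
              (\<Phi> \<in> G_infinity \<longrightarrow> (\<forall>\<^sub>F n in sequentially. characteristic (F n) = characteristic \<Phi>)) \<and>
              (\<Phi> \<in> imaginary_constants \<longrightarrow> (\<forall>\<^sub>F n in sequentially. characteristic (F n) = 0)))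
       \<and> closedin (compact_convergence_topology (half_plane 0)) (G_infinity \<union> imaginary_constants)"
proof (intro conjI[of "\<forall>F \<Phi>. _ F \<Phi>"] allI impI)
  fix F :: "nat \<Rightarrow> complex \<Rightarrow> complex" and \<Phi> :: "complex \<Rightarrow> complex"
  assume F: "\<forall>n. F n \<in> G_infinity"
    and lim: "\<forall>K. compact K \<and> K \<subseteq> half_plane 0 \<longrightarrow> uniform_limit K F \<Phi> sequentially"
  obtain c where c: "has_characteristic \<Phi> c" and hol: "\<Phi> holomorphic_on half_plane 0"
    and Re: "\<And>s. Re s > 0 \<Longrightarrow> Re (\<Phi> s) \<ge> real c * Re s"
    and ev: "eventually (\<lambda>n. characteristic (F n) = c) sequentially"
    and unif: "\<And>\<epsilon>. \<epsilon> > 0 \<Longrightarrow> uniform_limit (half_plane \<epsilon>) F \<Phi> sequentially"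
    using G_infinity_sequence_limit[of F \<Phi>] F lim by metis
  have "Re (\<Phi> s) \<ge> 0" if "Re s > 0" for s
    using Re[OF that] that mult_nonneg_nonneg[of "real c" "Re s"] by linarith
  then have dich: "\<Phi> \<in> G_infinity \<or> \<Phi> \<in> imaginary_constants"
    using nonneg_real_part_cases[OF hol] hol c by (auto simp: G_infinity_def)
  \<comment> \<open>At \<open>s = 1\<close> the inequality reads
    \<open>0 \<ge> real c\<close>.\<close>
  have "c = 0" if "\<Phi> \<in> imaginary_constants"
    using that Re[of 1] by (auto simp: imaginary_constants_def)
  then show "(\<forall>\<epsilon>>0. uniform_limit (half_plane \<epsilon>) F \<Phi> sequentially) \<and>
      (\<Phi> \<in> G_infinity \<or> \<Phi> \<in> imaginary_constants) \<and>
      (\<Phi> \<in> G_infinity \<longrightarrow> (\<forall>\<^sub>F n in sequentially. characteristic (F n) = characteristic \<Phi>)) \<and>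
      (\<Phi> \<in> imaginary_constants \<longrightarrow> (\<forall>\<^sub>F n in sequentially. characteristic (F n) = 0))"
    using unif dich ev characteristic_eqI[OF c] by auto
next
  show "closedin (compact_convergence_topology (half_plane 0)) (G_infinity \<union> imaginary_constants)"
  proof (rule closedin_compact_convergence_half_plane)
    fix F f
    assume F: "\<And>n. F n \<in> G_infinity \<union> imaginary_constants"
      and lim: "\<And>K. compact K \<Longrightarrow> K \<subseteq> half_plane 0 \<Longrightarrow> uniform_limit K F f sequentially"
    \<comment> \<open>Adding a small positive number moves the imaginary constants into \<open>G_infinity\<close>.\<close>
    define H where "H = (\<lambda>n s. F n s + (if F n \<in> G_infinity then 0 else of_real (inverse (real (Suc n)))))"
    have H: "H n \<in> G_infinity" for n
    proof (cases "F n \<in> G_infinity")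
      case True
      then show ?thesis by (simp add: H_def)
    next
      case False
      with F[of n] obtain t :: real where "\<forall>s\<in>half_plane 0. F n s = \<i> * of_real t"
        by (auto simp: imaginary_constants_def)
      then show ?thesis using False
        by (intro positive_constant_in_G_infinity[of "\<i> * of_real t + of_real (inverse (real (Suc n)))"])
          (auto simp: H_def simp del: of_nat_Suc)
    qed
    have lim_H: "uniform_limit K H f sequentially" if K: "compact K" "K \<subseteq> half_plane 0" for K
    proof -
      \<comment> \<open>The perturbation depends on \<open>n\<close> alone and tends to 0, so
        \<open>H\<close> has the same compact limit as \<open>F\<close>.\<close>
      define r where "r = (\<lambda>n. if F n \<in> G_infinity then 0 else complex_of_real (inverse (real (Suc n))))"
      have "r \<longlonglongrightarrow> 0"
        by (rule Lim_null_comparison[OF _ LIMSEQ_inverse_real_of_nat])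
          (auto simp: r_def norm_inverse simp del: of_nat_Suc)
      then have "uniform_limit K (\<lambda>n s. r n) (\<lambda>_. 0) sequentially"
        by (auto simp: uniform_limit_iff tendsto_iff elim: eventually_mono)
      from uniform_limit_add[OF lim[OF K] this] show ?thesis
        by (simp add: H_def r_def)
    qed
    obtain c where c: "has_characteristic f c" and hol: "f holomorphic_on half_plane 0"
      and Re: "\<And>s. Re s > 0 \<Longrightarrow> Re (f s) \<ge> real c * Re s"
      using G_infinity_sequence_limit[of H f] H lim_H by metis
    have "Re (f s) \<ge> 0" if "Re s > 0" for s
      using Re[OF that] that mult_nonneg_nonneg[of "real c" "Re s"] by linarith
    then show "f \<in> G_infinity \<union> imaginary_constants"
      using nonneg_real_part_cases[OF hol] hol c by (auto simp: G_infinity_def)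
  qed
qed

end
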